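(* Let $k$ be any field with $\operatorname{char} k=0$ and let $n\ge 3$. Then there exists an intermediate field $k\subset L\subset k(x_1,\ldots,x_n)$ with $[k(x_1,\ldots,x_n):L]=2$ such that the $k$-algebra $L\cap k[x_1,\ldots,x_n]$ is not finitely generated.
   Context: $k[x_1,\ldots,x_n]$ is the polynomial ring in $n$ variables over $k$, and $k(x_1,\ldots,x_n)$ is its field of fractions. *)

theory Defs
  imports
    "HOL-Library.Poly_Mapping"
    "HOL-Computational_Algebra.Fraction_Field"
    "HOL-Algebra.Embedded_Algebras"
    "HOL-Algebra.Generated_Rings"
    "HOL-Algebra.Algebraic_Closure_Type"
begin

text \<open>
  Polynomials are finitely supported maps from monomials (exponent vectors) to coefficients.
  The types provide a countable supply of variables; \<open>n\<close> selects the variables with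
  indices \<open>0, \<dots>, n - 1\<close>, which play the role of \<open>x\<^sub>1, \<dots>, x\<^sub>n\<close>.
\<close>

type_synonym 'k mpoly_type = "(nat \<Rightarrow>\<^sub>0 nat) \<Rightarrow>\<^sub>0 'k"
type_synonym 'k ratfun_type = "'k mpoly_type fract"

definition polys_in :: "nat \<Rightarrow> 'k::field mpoly_type set" where
  "polys_in n = {p. \<forall>m \<in> Poly_Mapping.keys p. Poly_Mapping.keys m \<subseteq> {..<n}}"

definition ratfun_field :: "nat \<Rightarrow> 'k::field ratfun_type ring" where
  "ratfun_field n =
     ring_of_type_algebra\<lparr>carrier := {Fract p q | p q. p \<in> polys_in n \<and> q \<in> polys_in n \<and> q \<noteq> 0}\<rparr>"

definition poly_subring :: "nat \<Rightarrow> 'k::field ratfun_type set" where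
  "poly_subring n = {Fract p 1 | p. p \<in> polys_in n}"

definition constants :: "'k::field ratfun_type set" where
  "constants = range (\<lambda>c. Fract (Poly_Mapping.single 0 c) 1)"

text \<open>
  \<open>A\<close> is a finitely generated algebra over the subring \<open>K\<close> of the commutative ring \<open>R\<close>,
  i.e. \<open>A = K[a\<^sub>1, \<dots>, a\<^sub>r]\<close> for finitely many elements of \<open>A\<close>.
\<close>

definition finitely_generated_algebra :: "('a, 'b) ring_scheme \<Rightarrow> 'a set \<Rightarrow> 'a set \<Rightarrow> bool" where
  "finitely_generated_algebra R K A \<longleftrightarrow>
     (\<exists>S. finite S \<and> S \<subseteq> A \<and> A = generate_ring R (K \<union> S))"

lemma polys_in_0: "0 \<in> polys_in n"
  and polys_in_const: "Poly_Mapping.single 0 c \<in> polys_in n"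
  and polys_in_1: "1 \<in> polys_in n"
  by (auto simp: polys_in_def)

lemma polys_in_uminus: "p \<in> polys_in n \<Longrightarrow> - p \<in> polys_in n"
  by (simp add: polys_in_def)

lemma polys_in_add: "p \<in> polys_in n \<Longrightarrow> q \<in> polys_in n \<Longrightarrow> p + q \<in> polys_in n"
  unfolding polys_in_def using Poly_Mapping.keys_add[of p q] by blast

lemma polys_in_mult:
  assumes "p \<in> polys_in n" "q \<in> polys_in n"
  shows "p * q \<in> polys_in n"
  unfolding polys_in_def
proof safe
  fix m i
  assume m: "m \<in> Poly_Mapping.keys (p * q)" and i: "i \<in> Poly_Mapping.keys m"
  from m obtain a b where "m = a + b" "a \<in> Poly_Mapping.keys p" "b \<in> Poly_Mapping.keys q"
    using Poly_Mapping.keys_mult[of p q] by blast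
  with i assms show "i < n"
    using Poly_Mapping.keys_add[of a b] unfolding polys_in_def by blast
qed

lemma subfield_ratfun: "subfield (carrier (ratfun_field n)) (ring_of_type_algebra :: 'k::field ratfun_type ring)"
proof -
  let ?R = "ring_of_type_algebra :: 'k ratfun_type ring"
  let ?K = "carrier (ratfun_field n :: 'k ratfun_type ring)"
  interpret R: Ring.field ?R by (rule field_from_type_algebra)
  have R: "carrier ?R = UNIV" "monoid.mult ?R = (*)" "add ?R = (+)" "one ?R = 1" "zero ?R = 0"
    by (simp_all add: ring_of_type_algebra_def)
  have memI: "Fract p q \<in> ?K" if "p \<in> polys_in n" "q \<in> polys_in n" "q \<noteq> 0" for p q
    using that by (auto simp: ratfun_field_def)
  have memE: "\<exists>p q. x = Fract p q \<and> p \<in> polys_in n \<and> q \<in> polys_in n \<and> q \<noteq> 0" if "x \<in> ?K" for x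
    using that by (auto simp: ratfun_field_def)
  have minus: "\<ominus>\<^bsub>?R\<^esub> x = - x" for x
    by (rule R.minus_equality) (simp_all add: R)
  have inv_R: "inv\<^bsub>?R\<^esub> x = inverse x" if "x \<noteq> 0" for x
    by (rule R.comm_inv_char) (simp_all add: R that)
  have sub: "subcring ?K ?R"
  proof (rule R.subcringI', rule R.subringI)
    show "\<one>\<^bsub>?R\<^esub> \<in> ?K"
      using memI[of 1 1] by (simp add: R One_fract_def polys_in_1)
    show "\<ominus>\<^bsub>?R\<^esub> h \<in> ?K" if "h \<in> ?K" for h
      using memE[OF that] by (auto simp: minus intro!: memI polys_in_uminus)
    show "h1 \<otimes>\<^bsub>?R\<^esub> h2 \<in> ?K" if "h1 \<in> ?K" "h2 \<in> ?K" for h1 h2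
      using memE[OF that(1)] memE[OF that(2)] by (auto simp: R intro!: memI polys_in_mult)
    show "h1 \<oplus>\<^bsub>?R\<^esub> h2 \<in> ?K" if "h1 \<in> ?K" "h2 \<in> ?K" for h1 h2
      using memE[OF that(1)] memE[OF that(2)] by (auto simp: R intro!: memI polys_in_mult polys_in_add)
  qed (simp add: R)
  show ?thesis
  proof (rule R.subfieldI'[OF subcring.axioms(1)[OF sub]])
    fix x assume x: "x \<in> ?K - {\<zero>\<^bsub>?R\<^esub>}"
    then obtain p q where pq: "x = Fract p q" "p \<in> polys_in n" "q \<in> polys_in n" "q \<noteq> 0"
      using memE by blast
    with x have "p \<noteq> 0" by (auto simp: R eq_fract Zero_fract_def)
    with pq x show "inv\<^bsub>?R\<^esub> x \<in> ?K" by (auto simp: inv_R R intro!: memI)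
  qed
qed

lemma field_ratfun_field: "field (ratfun_field n :: 'k::field ratfun_type ring)"
proof -
  interpret R: Ring.field "ring_of_type_algebra :: 'k ratfun_type ring"
    by (rule field_from_type_algebra)
  show ?thesis
    using R.subfield_iff(2)[OF subfield_ratfun[of n]] by (simp add: ratfun_field_def)
qed

end

theory Submission
  imports Defs "HOL-Computational_Algebra.Formal_Power_Series"
begin

text \<open>
  Write \<open>x, y, z\<close> for the first three variables. The field \<open>L\<close> is the fixed field of the involution \<open>\<tau>\<close>
  that swaps \<open>x\<close> and \<open>y\<close>, sends \<open>z\<close> to \<open>-(x\<^sup>5y\<^sup>4z + (x - y)\<^sup>2) / (x\<^sup>4y\<^sup>5)\<close> and fixes the other variables.
  It is homogeneous for the weights \<open>1, 1, -7\<close>.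

  In the homogeneous part of degree \<open>d\<close>, let \<open>v\<close> be the \<open>z\<close>-adic order of an invariant polynomial. Comparing
  lowest coefficients along \<open>z = 0\<close> and \<open>\<tau>(z) = 0\<close>, two curves that are tangent at \<open>x = y\<close>, shows that
  \<open>(x - y)\<^sup>2\<^sup>v\<close> divides the lowest coefficient, whose degree is \<open>d + 7v\<close>; hence \<open>d + 5v \<ge> 0\<close>. Equality forces
  \<open>(y/x)\<^sup>v \<equiv> 1\<close> modulo \<open>(x - y)\<^sup>2\<close>, so \<open>v = 0\<close> in characteristic \<open>0\<close>. Thus every
  monomial \<open>x\<^sup>iy\<^sup>jz\<^sup>l\<close> of an invariant polynomial with \<open>l > 0\<close> satisfies \<open>i + j > 2l\<close>. On the other hand there are
  invariant polynomials containing such a monomial with \<open>i + j = 2l + 1\<close> for every \<open>l \<ge> 1\<close>, whereas finitely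
  many generators would bound \<open>l\<close> by \<open>N (i + j - 2l)\<close> with a constant \<open>N\<close>.
\<close>

section \<open>Evaluation of polynomials\<close>

text \<open>Evaluation maps, Taylor expansion at 1 and the involution itself all share this
  interface, so that a single set of rewrite rules serves them.\<close>

locale unital_ring_hom =
  fixes f :: "'a::comm_ring_1 \<Rightarrow> 'b::comm_ring_1"
  assumes one: "f 1 = 1"
    and add: "f (x + y) = f x + f y"
    and mult: "f (x * y) = f x * f y"
begin

lemma zero: "f 0 = 0"
  using add[of 0 0] by simp

lemma uminus: "f (- x) = - f x"
  using add[of x "- x"] by (simp add: zero eq_neg_iff_add_eq_0 add.commute)

lemma diff: "f (x - y) = f x - f y"
  using add[of x "- y"] by (simp add: uminus)

lemma sum: "f (sum g A) = (\<Sum>i\<in>A. f (g i))"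
  by (induction A rule: infinite_finite_induct) (auto simp: zero add)

lemma prod: "f (prod g A) = (\<Prod>i\<in>A. f (g i))"
  by (induction A rule: infinite_finite_induct) (auto simp: one mult)

lemma power: "f (x ^ n) = f x ^ n"
  by (induction n) (auto simp: one mult)

lemma of_nat: "f (of_nat n) = of_nat n"
  by (induction n) (auto simp: zero one add)

lemma numeral: "f (numeral n) = numeral n"
  using of_nat[of "numeral n"] by simp

lemmas simps = zero one add mult uminus diff sum prod power of_nat numeral

lemma map_poly: "unital_ring_hom (map_poly f)"
proof
  show "map_poly f 1 = 1" by (simp add: one)
  show "map_poly f (p + q) = map_poly f p + map_poly f q" for p q
    by (rule poly_eqI) (simp add: coeff_map_poly zero add)
  show "map_poly f (p * q) = map_poly f p * map_poly f q" for p q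
    by (rule poly_eqI) (simp add: coeff_map_poly zero sum mult coeff_mult)
qed

end

lemma unital_ring_hom_poly: "unital_ring_hom (\<lambda>p. poly p a)"
  by unfold_locales auto

lemma unital_ring_hom_comp:
  assumes "unital_ring_hom f" "unital_ring_hom g"
  shows "unital_ring_hom (\<lambda>x. f (g x))"
proof -
  interpret f: unital_ring_hom f by fact
  interpret g: unital_ring_hom g by fact
  show ?thesis by unfold_locales (simp_all add: f.simps g.simps)
qed

section \<open>Multivariate polynomials evaluated in arbitrary commutative rings\<close>

definition monomial_eval :: "(nat \<Rightarrow> 'r::comm_ring_1) \<Rightarrow> (nat \<Rightarrow>\<^sub>0 nat) \<Rightarrow> 'r" where
  "monomial_eval v m = (\<Prod>i\<in>Poly_Mapping.keys m. v i ^ Poly_Mapping.lookup m i)"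

text \<open>The map \<open>\<phi>\<close> on coefficients is explicit because the same polynomial is
  evaluated in the function field, in Laurent polynomials over power series and in iterated
  polynomial rings.\<close>

definition mpoly_eval :: "('k::comm_ring_1 \<Rightarrow> 'r::comm_ring_1) \<Rightarrow> (nat \<Rightarrow> 'r) \<Rightarrow> ((nat \<Rightarrow>\<^sub>0 nat) \<Rightarrow>\<^sub>0 'k) \<Rightarrow> 'r" where
  "mpoly_eval \<phi> v p = (\<Sum>m\<in>Poly_Mapping.keys p. \<phi> (Poly_Mapping.lookup p m) * monomial_eval v m)"

lemma monomial_eval_superset:
  assumes "finite A" "Poly_Mapping.keys m \<subseteq> A"
  shows "monomial_eval v m = (\<Prod>i\<in>A. v i ^ Poly_Mapping.lookup m i)"
  unfolding monomial_eval_def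
  by (rule prod.mono_neutral_left) (use assms in \<open>auto simp: in_keys_iff\<close>)

lemma monomial_eval_0 [simp]: "monomial_eval v 0 = 1"
  by (simp add: monomial_eval_def)

lemma monomial_eval_single [simp]: "monomial_eval v (Poly_Mapping.single i n) = v i ^ n"
  by (simp add: monomial_eval_def)

lemma monomial_eval_add: "monomial_eval v (a + b) = monomial_eval v a * monomial_eval v b"
proof -
  let ?A = "Poly_Mapping.keys a \<union> Poly_Mapping.keys b"
  have "monomial_eval v (a + b) = (\<Prod>i\<in>?A. v i ^ Poly_Mapping.lookup (a + b) i)"
    by (rule monomial_eval_superset) (use Poly_Mapping.keys_add[of a b] in auto)
  also have "\<dots> = (\<Prod>i\<in>?A. v i ^ Poly_Mapping.lookup a i) * (\<Prod>i\<in>?A. v i ^ Poly_Mapping.lookup b i)"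
    by (simp add: lookup_add power_add prod.distrib)
  also have "\<dots> = monomial_eval v a * monomial_eval v b"
    by (simp add: monomial_eval_superset[of ?A])
  finally show ?thesis .
qed

lemma poly_mapping_induct [case_names single add]:
  fixes p :: "'a \<Rightarrow>\<^sub>0 'b::comm_monoid_add"
  assumes single: "\<And>m c. P (Poly_Mapping.single m c)"
    and add: "\<And>p q. P p \<Longrightarrow> P q \<Longrightarrow> P (p + q)"
  shows "P p"
proof (induction p rule: Poly_Mapping.update_induct)
  case const
  then show ?case using single[of undefined 0] by simp
next
  case (update f a b)
  have "Poly_Mapping.update a b f = Poly_Mapping.single a b + f"
    by (rule poly_mapping_eqI)
       (use update(1) in \<open>auto simp: lookup_update lookup_add lookup_single in_keys_iff when_def\<close>)
  with update single add show ?case by metis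
qed

context unital_ring_hom
begin

lemma mpoly_eval_superset:
  assumes "finite A" "Poly_Mapping.keys p \<subseteq> A"
  shows "mpoly_eval f v p = (\<Sum>m\<in>A. f (Poly_Mapping.lookup p m) * monomial_eval v m)"
  unfolding mpoly_eval_def
  by (rule sum.mono_neutral_left) (use assms in \<open>auto simp: in_keys_iff zero\<close>)

lemma mpoly_eval_single [simp]:
  "mpoly_eval f v (Poly_Mapping.single m c) = f c * monomial_eval v m"
  by (subst mpoly_eval_superset[of "{m}"]) auto

lemma mpoly_eval_add: "mpoly_eval f v (p + q) = mpoly_eval f v p + mpoly_eval f v q"
proof -
  let ?A = "Poly_Mapping.keys p \<union> Poly_Mapping.keys q"
  have "mpoly_eval f v (p + q) = (\<Sum>m\<in>?A. f (Poly_Mapping.lookup (p + q) m) * monomial_eval v m)"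
    by (rule mpoly_eval_superset) (use Poly_Mapping.keys_add[of p q] in auto)
  also have "\<dots> = (\<Sum>m\<in>?A. f (Poly_Mapping.lookup p m) * monomial_eval v m)
      + (\<Sum>m\<in>?A. f (Poly_Mapping.lookup q m) * monomial_eval v m)"
    by (simp add: lookup_add add algebra_simps sum.distrib)
  also have "\<dots> = mpoly_eval f v p + mpoly_eval f v q"
    by (simp add: mpoly_eval_superset[of ?A])
  finally show ?thesis .
qed

lemma mpoly_eval_hom: "unital_ring_hom (mpoly_eval f v)"
proof
  show "mpoly_eval f v 1 = 1"
    using mpoly_eval_single[of v 0 1] by (simp add: one)
  show "mpoly_eval f v (p + q) = mpoly_eval f v p + mpoly_eval f v q" for p q
    by (rule mpoly_eval_add)
  have single: "mpoly_eval f v (Poly_Mapping.single m c * q)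
      = mpoly_eval f v (Poly_Mapping.single m c) * mpoly_eval f v q" for m c q
    by (induction q rule: poly_mapping_induct)
       (simp_all add: mult_single mult monomial_eval_add mpoly_eval_add algebra_simps)
  show "mpoly_eval f v (p * q) = mpoly_eval f v p * mpoly_eval f v q" for p q
    by (induction p rule: poly_mapping_induct)
       (simp_all only: single distrib_right mpoly_eval_add)
qed

end

lemma (in unital_ring_hom) comp_mpoly_eval:
  "f (mpoly_eval \<phi> v p) = mpoly_eval (\<lambda>c. f (\<phi> c)) (\<lambda>i. f (v i)) p"
  by (simp add: mpoly_eval_def monomial_eval_def simps)

lemma mpoly_induct [case_names const var add mult]:
  fixes p :: "(nat \<Rightarrow>\<^sub>0 nat) \<Rightarrow>\<^sub>0 'k::comm_ring_1"
  assumes const: "\<And>c. P (Poly_Mapping.single 0 c)"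
    and var: "\<And>i. P (Poly_Mapping.single (Poly_Mapping.single i 1) 1)"
    and add: "\<And>p q. P p \<Longrightarrow> P q \<Longrightarrow> P (p + q)"
    and mult: "\<And>p q. P p \<Longrightarrow> P q \<Longrightarrow> P (p * q)"
  shows "P p"
proof (induction p rule: poly_mapping_induct)
  case (single m c)
  have pow: "P (Poly_Mapping.single (Poly_Mapping.single i n) 1)" for i n
  proof (induction n)
    case 0
    then show ?case using const[of 1] by simp
  next
    case (Suc n)
    have "Poly_Mapping.single (Poly_Mapping.single i (Suc n)) (1::'k) =
        Poly_Mapping.single (Poly_Mapping.single i 1) 1 * Poly_Mapping.single (Poly_Mapping.single i n) 1"
      by (simp add: mult_single flip: single_add)
    then show ?case using mult[OF var[of i] Suc] by simp
  qed
  have "P (Poly_Mapping.single m 1)"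
  proof (induction m rule: poly_mapping_induct)
    case (single i n)
    then show ?case by (rule pow)
  next
    case (add a b)
    have "Poly_Mapping.single (a + b) (1::'k) = Poly_Mapping.single a 1 * Poly_Mapping.single b 1"
      by (simp add: mult_single)
    then show ?case using mult[OF add] by simp
  qed
  from mult[OF const[of c] this] show ?case by (simp add: mult_single)
next
  case (add p q)
  then show ?case by (rule assms(3))
qed

section \<open>Univariate polynomials\<close>

lemma pcompose_power: "pcompose (p ^ n) q = pcompose p q ^ n"
  for p q :: "'a::comm_ring_1 poly"
  by (induction n) (simp_all add: pcompose_1 pcompose_mult)

lemma pderiv_sum: "pderiv (sum f A) = (\<Sum>i\<in>A. pderiv (f i))"
  for f :: "_ \<Rightarrow> 'a::idom poly"
  by (induction A rule: infinite_finite_induct) (simp_all add: pderiv_add)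

text \<open>Put q = \<beta> + \<alpha> z. Then F is divisible by z^v and, through G, by q^v. As
  \<beta> is nonzero, z does not divide q, so F = z^v q^v G2. Up to explicit factors the two lowest
  coefficients are the values of G2 at z = 0 and at the zero of q, and these agree modulo
  \<beta>.\<close>

lemma affine_pcompose_lowest_coeff:
  fixes F G :: "'a::idom poly"
  assumes FG: "F = pcompose G [:\<beta>, \<alpha>:]" and unit: "\<alpha> * \<alpha>' = 1" and "\<beta> \<noteq> 0"
    and F: "\<And>l. l < v \<Longrightarrow> coeff F l = 0" and G: "\<And>l. l < v \<Longrightarrow> coeff G l = 0"
  obtains g r where "coeff F v = \<beta> ^ v * g" "(- \<alpha>) ^ v * coeff G v = \<beta> ^ v * (g + \<beta> * r)"
proof -
  have "monom 1 v dvd F" "monom 1 v dvd G"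
    using F G by (auto simp: monom_1_dvd_iff')
  then obtain F1 G1 where F1: "F = monom 1 v * F1" and G1: "G = monom 1 v * G1"
    by (auto elim!: dvdE)
  let ?q = "[:\<beta>, \<alpha>:]"
  let ?G = "pcompose G1 ?q"
  have eq: "monom 1 v * F1 = ?q ^ v * ?G"
    using FG unfolding F1 G1 by (simp add: monom_altdef pcompose_mult pcompose_power pcompose_pCons)
  have "monom 1 v dvd ?G"
  proof (cases "?G = 0")
    case False
    \<comment> \<open>The factor q^v does not vanish at 0, so the whole order v at 0 has to come
      from the other factor.\<close>
    have "[:0, 1:] ^ v dvd ?q ^ v * ?G"
      unfolding eq[symmetric] by (simp add: monom_altdef)
    moreover have "order 0 (?q ^ v) = 0"
      using \<open>\<beta> \<noteq> 0\<close> by (intro order_0I) simp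
    moreover have nz: "?q ^ v * ?G \<noteq> 0"
      using False \<open>\<beta> \<noteq> 0\<close> by simp
    ultimately have "v \<le> order 0 ?G"
      using order_divides[of 0 v "?q ^ v * ?G"] order_mult[OF nz, of 0] nz by auto
    then show ?thesis
      using order_divides[of 0 v ?G] by (simp add: monom_altdef)
  qed simp
  then obtain G2 where G2: "?G = monom 1 v * G2" by (auto elim!: dvdE)
  have "monom 1 v * F1 = monom 1 v * (?q ^ v * G2)"
    unfolding eq G2 by (rule mult.left_commute)
  then have F1': "F1 = ?q ^ v * G2"
    by (simp only: mult_cancel_left monom_eq_0_iff one_neq_zero simp_thms)
  \<comment> \<open>This is the zero of q, where the argument of G1 becomes 0. It is a multiple of
    \<beta>, hence so is G2(a) - G2(0).\<close>
  define a where "a = - \<beta> * \<alpha>'"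
  have "poly ?q a = 0"
    using unit by (simp add: a_def algebra_simps)
  then have "poly ?G a = poly G1 0" by (simp add: poly_pcompose)
  with G2 have G10: "poly G1 0 = a ^ v * poly G2 a" by (simp add: poly_monom)
  obtain s where s: "G2 = pCons (poly G2 0) s"
    by (cases G2) auto
  have G2a: "poly G2 a = poly G2 0 + a * poly s a"
    by (subst s) simp
  have "coeff F v = poly F1 0"
    unfolding F1 by (simp add: coeff_monom_mult poly_0_coeff_0)
  then have 1: "coeff F v = \<beta> ^ v * poly G2 0"
    by (simp add: F1')
  have "coeff G v = poly G1 0"
    unfolding G1 by (simp add: coeff_monom_mult poly_0_coeff_0)
  moreover have "(- \<alpha>) ^ v * a ^ v = \<beta> ^ v"
  proof -
    have "- \<alpha> * a = (\<alpha> * \<alpha>') * \<beta>" by (simp add: a_def mult_ac)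
    then show ?thesis by (simp add: unit flip: power_mult_distrib)
  qed
  ultimately have "(- \<alpha>) ^ v * coeff G v = \<beta> ^ v * (poly G2 0 + a * poly s a)"
    unfolding G10 G2a by (metis mult.assoc)
  then have "(- \<alpha>) ^ v * coeff G v = \<beta> ^ v * (poly G2 0 + \<beta> * (- \<alpha>' * poly s a))"
    by (simp add: a_def)
  from that[OF 1 this] show ?thesis .
qed

text \<open>This is x^N f(1/x), with a formal degree N that may exceed the degree of f. For the
  dehomogenisation of a form of degree N in x and y it is the effect of exchanging x and y.\<close>

definition reflect :: "nat \<Rightarrow> 'a::comm_ring_1 poly \<Rightarrow> 'a poly" where
  "reflect N f = (\<Sum>i\<le>N. monom (coeff f i) (N - i))"

lemma degree_reflect: "degree (reflect N f) \<le> N"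
  unfolding reflect_def
  by (intro degree_sum_le) (auto intro: order.trans[OF degree_monom_le])

context unital_ring_hom begin

definition poly_eval :: "'b \<Rightarrow> 'a poly \<Rightarrow> 'b" where
  "poly_eval a p = poly (map_poly f p) a"

lemma poly_eval_hom: "unital_ring_hom (poly_eval a)"
  unfolding poly_eval_def by (rule unital_ring_hom_comp[OF unital_ring_hom_poly map_poly])

lemma poly_eval_monom: "poly_eval a (monom c n) = f c * a ^ n"
  by (simp add: poly_eval_def map_poly_monom zero poly_monom)

lemma poly_eval_0: "poly_eval a 0 = 0"
  by (simp add: poly_eval_def)

lemma poly_eval_pCons: "poly_eval a (pCons c p) = f c + a * poly_eval a p"
  by (simp add: poly_eval_def map_poly_pCons zero)

end

lemma (in unital_ring_hom) poly_eval_reflect: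
  assumes "degree p \<le> N" "a * b = 1"
  shows "poly_eval a (reflect N p) = a ^ N * poly_eval b p"
proof -
  interpret ea: unital_ring_hom "poly_eval a" by (rule poly_eval_hom)
  interpret eb: unital_ring_hom "poly_eval b" by (rule poly_eval_hom)
  have "poly_eval a (reflect N p) = (\<Sum>i\<le>N. f (coeff p i) * a ^ (N - i))"
    by (simp add: reflect_def ea.sum poly_eval_monom)
  also have "\<dots> = (\<Sum>i\<le>N. a ^ N * (f (coeff p i) * b ^ i))"
  proof (rule sum.cong)
    fix i assume "i \<in> {..N}"
    then have "a ^ N = a ^ (N - i) * a ^ i"
      by (simp flip: power_add)
    then have "a ^ N * b ^ i = a ^ (N - i) * (a * b) ^ i"
      by (simp only: power_mult_distrib mult.assoc)
    then have "a ^ N * b ^ i = a ^ (N - i)"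
      by (simp add: assms(2))
    then show "f (coeff p i) * a ^ (N - i) = a ^ N * (f (coeff p i) * b ^ i)"
      by (metis mult.left_commute mult.commute)
  qed simp
  also have "\<dots> = a ^ N * poly_eval b (\<Sum>i\<le>N. monom (coeff p i) i)"
    by (simp add: eb.sum poly_eval_monom sum_distrib_left)
  also have "(\<Sum>i\<le>N. monom (coeff p i) i) = p"
    by (rule poly_as_sum_of_monoms') fact
  finally show ?thesis .
qed

lemma double_root_dvd:
  fixes p :: "'a::idom poly"
  assumes "poly p a = 0" "poly (pderiv p) a = 0"
  shows "[:-a, 1:] ^ 2 dvd p"
proof -
  obtain q where q: "p = [:-a, 1:] * q"
    using assms(1) by (auto simp: poly_eq_0_iff_dvd)
  have "poly q a = 0"
    using assms(2) unfolding q pderiv_mult by (simp add: pderiv_pCons del: mult_pCons_left)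
  then have "[:-a, 1:] dvd q"
    by (simp add: poly_eq_0_iff_dvd)
  then show ?thesis
    unfolding q power2_eq_square by (intro mult_dvd_mono dvd_refl)
qed

text \<open>The difference always vanishes at 1, and its derivative there is 2 f'(1) - N f(1). The
  hypothesis says exactly that this is 0, which makes 1 a double root.\<close>

lemma diff_reflect_double_root:
  fixes f :: "'a::idom poly"
  assumes deg: "degree f \<le> N" and "2 * poly (pderiv f) 1 = of_nat N * poly f 1"
  obtains q where "f - reflect N f = [:1, -1:] ^ 2 * q" "degree q \<le> N"
proof -
  let ?d = "f - reflect N f"
  have f: "f = (\<Sum>i\<le>N. monom (coeff f i) i)"
    using poly_as_sum_of_monoms'[OF deg] by simp
  have p1: "poly f 1 = (\<Sum>i\<le>N. coeff f i)"
    using arg_cong[OF f, of "\<lambda>g. poly g 1"] by (simp add: poly_sum poly_monom)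
  have d1: "poly (pderiv f) 1 = (\<Sum>i\<le>N. of_nat i * coeff f i)"
    using arg_cong[OF f, of "\<lambda>g. poly (pderiv g) 1"]
    by (simp add: pderiv_sum pderiv_monom poly_sum poly_monom)
  have r1: "poly (reflect N f) 1 = poly f 1"
    by (simp add: p1 reflect_def poly_sum poly_monom)
  have "poly (pderiv (reflect N f)) 1 = (\<Sum>i\<le>N. of_nat (N - i) * coeff f i)"
    by (simp add: reflect_def pderiv_sum pderiv_monom poly_sum poly_monom)
  also have "\<dots> = (\<Sum>i\<le>N. of_nat N * coeff f i - of_nat i * coeff f i)"
    by (intro sum.cong) (auto simp: of_nat_diff algebra_simps)
  also have "\<dots> = of_nat N * poly f 1 - poly (pderiv f) 1"
    by (simp add: p1 d1 sum_subtractf sum_distrib_left)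
  finally have "poly (pderiv ?d) 1 = 0"
    using assms(2) by (simp add: pderiv_diff)
  then have "[:-1, 1:] ^ 2 dvd ?d"
    by (intro double_root_dvd) (simp_all add: r1)
  then obtain q where "?d = [:-1, 1:] ^ 2 * q" by (auto elim!: dvdE)
  also have "[:-1, 1:] ^ 2 = ([:1, -1:] ^ 2 :: 'a poly)"
    by (simp add: power2_eq_square)
  finally have q: "?d = [:1, -1:] ^ 2 * q" .
  have "degree q \<le> N"
  proof (cases "q = 0")
    case False
    then have "degree q \<le> degree ([:1, -1:] ^ 2 * q)"
      by (subst degree_mult_eq) auto
    also have "\<dots> \<le> N"
      unfolding q[symmetric] using deg degree_reflect[of N f] by (rule degree_diff_le)
    finally show ?thesis .
  qed simp
  with q that show ?thesis by blast
qed

text \<open>Since g(0) is nonzero, g is invertible modulo every power of the variable; f is built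
  one coefficient at a time.\<close>

lemma solve_mod_monom:
  fixes e g :: "'a::field poly"
  assumes "coeff g 0 \<noteq> 0"
  shows "\<exists>f. degree f \<le> k \<and> monom 1 k dvd e + g * f"
proof (induction k)
  case 0
  show ?case by (intro exI[of _ 0]) (simp add: one_pCons[symmetric] monom_0)
next
  case (Suc k)
  then obtain f r where f: "degree f \<le> k" and r: "e + g * f = monom 1 k * r"
    by (auto elim!: dvdE)
  \<comment> \<open>This value cancels the constant term of the remainder r.\<close>
  define b where "b = - coeff r 0 / coeff g 0"
  have "coeff (r + [:b:] * g) 0 = 0"
    using assms by (simp add: b_def)
  then have "monom 1 1 dvd r + [:b:] * g"
    by (subst monom_1_dvd_iff') simp
  then have "monom 1 k * monom 1 1 dvd monom 1 k * (r + [:b:] * g)"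
    by (intro mult_dvd_mono) auto
  also have "monom 1 k * monom 1 1 = (monom 1 (Suc k) :: 'a poly)"
    by (simp add: mult_monom)
  also have "monom 1 k * (r + [:b:] * g) = e + g * (f + monom b k)"
  proof -
    have "monom b k = monom 1 k * [:b:]" by (simp add: mult_monom flip: monom_0)
    then show ?thesis
      by (simp only: distrib_left r[symmetric]) (simp add: ac_simps)
  qed
  finally have "monom 1 (Suc k) dvd e + g * (f + monom b k)" .
  moreover have "degree (f + monom b k) \<le> Suc k"
    using f by (intro degree_add_le) (auto intro: order.trans[OF degree_monom_le])
  ultimately show ?case by blast
qed

lemma degree_coeff_mult_le:
  fixes A B :: "'a::comm_ring_1 poly poly"
  assumes "\<And>l. degree (coeff A l) \<le> M" "\<And>l. degree (coeff B l) \<le> N"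
  shows "degree (coeff (A * B) l) \<le> M + N"
  unfolding coeff_mult
  by (intro degree_sum_le) (auto intro!: order.trans[OF degree_mult_le] add_mono assms)

lemma degree_coeff_power_le:
  fixes A :: "'a::comm_ring_1 poly poly"
  assumes "\<And>l. degree (coeff A l) \<le> M"
  shows "degree (coeff (A ^ n) l) \<le> n * M"
proof (induction n arbitrary: l)
  case 0
  then show ?case by simp
next
  case (Suc n)
  show ?case using degree_coeff_mult_le[OF assms Suc] by simp
qed

section \<open>Polynomials compatible with the involution\<close>

definition bipoly_eval :: "('a::comm_ring_1 \<Rightarrow> 'b::comm_ring_1) \<Rightarrow> 'b \<Rightarrow> 'b \<Rightarrow> 'a poly poly \<Rightarrow> 'b" where
  "bipoly_eval \<phi> a b H = unital_ring_hom.poly_eval (unital_ring_hom.poly_eval \<phi> a) b H"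

lemma bipoly_eval_hom: "unital_ring_hom \<phi> \<Longrightarrow> unital_ring_hom (bipoly_eval \<phi> a b)"
  unfolding bipoly_eval_def by (intro unital_ring_hom.poly_eval_hom)

text \<open>
  \<open>\<eta>\<close> and \<open>T\<close> stand for \<open>y/x\<close> and \<open>x\<^sup>3y\<^sup>4z\<close>; the involution maps them to the arguments on the right-hand side.
\<close>

definition quasi_invariant :: "('a::comm_ring_1 \<Rightarrow> 'b::field) \<Rightarrow> nat \<Rightarrow> 'a poly poly \<Rightarrow> bool" where
  "quasi_invariant \<phi> c H \<longleftrightarrow> (\<forall>\<eta> T. \<eta> \<noteq> 0 \<longrightarrow> \<eta> \<noteq> 1 \<longrightarrow>
    bipoly_eval \<phi> \<eta> T H = \<eta> ^ (c + 1) * bipoly_eval \<phi> (1 / \<eta>) (- (T + (1 - \<eta>)\<^sup>2) / \<eta>\<^sup>2) H)"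

lemma quasi_invariant_add:
  assumes "unital_ring_hom \<phi>" "quasi_invariant \<phi> c G" "quasi_invariant \<phi> c H"
  shows "quasi_invariant \<phi> c (G + H)"
  using assms(2,3) unfolding quasi_invariant_def
  by (simp only: unital_ring_hom.add[OF bipoly_eval_hom[OF assms(1)]] distrib_left) metis

text \<open>Take H = S^j (f + q T) with S = T (T + (1 - \<eta>)^2) and q = (f -
  \<open>reflect (k + 1) f\<close>) / (1 - \<eta>)^2. The involution divides S by \<eta>^4, which
  gives weight 4 j. The linear factor has weight k + 1, because q is antisymmetric and the shift of
  T by (1 - \<eta>)^2 turns the reversed f back into f. The total weight is c + 1.\<close>

lemma quasi_invariant_term:
  fixes \<phi> :: "'k::field_char_0 \<Rightarrow> 'r::field" and f :: "'k poly"
  assumes hom: "unital_ring_hom \<phi>" and c: "c = 4 * j + k"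
    and deg: "degree f \<le> k + 1" and der: "2 * poly (pderiv f) 1 = of_nat (k + 1) * poly f 1"
  obtains H where "\<And>l. l < j \<Longrightarrow> coeff H l = 0" "coeff H j = [:1, -1:] ^ (2 * j) * f"
    "\<And>l. degree (coeff H l) \<le> c + 1"
    "quasi_invariant \<phi> c H"
proof -
  obtain q where q: "f - reflect (k + 1) f = [:1, -1:] ^ 2 * q" and degq: "degree q \<le> k + 1"
    using diff_reflect_double_root[OF deg der] .
  define w :: "'k poly" where "w = [:1, -1:] ^ 2"
  define S :: "'k poly poly" where "S = [:0, w, 1:]"
  define H where "H = S ^ j * [:f, q:]"
  have S: "S = monom 1 1 * [:w, 1:]"
    by (simp add: S_def monom_altdef)
  have H: "H = monom 1 j * ([:w, 1:] ^ j * [:f, q:])"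
    unfolding H_def S power_mult_distrib monom_power by (simp only: mult.assoc power_one mult_1)
  have 1: "coeff H l = 0" if "l < j" for l
    using that by (simp add: H coeff_monom_mult)
  have "coeff H j = coeff ([:w, 1:] ^ j * [:f, q:]) 0"
    by (simp add: H coeff_monom_mult)
  then have 2: "coeff H j = [:1, -1:] ^ (2 * j) * f"
    by (simp add: coeff_mult_0 coeff_0_power w_def power_mult)
  have "degree (coeff S l) \<le> 2" for l
    by (auto simp: S_def coeff_pCons w_def power2_eq_square split: nat.splits)
  then have "degree (coeff (S ^ j) l) \<le> j * 2" for l
    by (rule degree_coeff_power_le)
  moreover have "degree (coeff [:f, q:] l) \<le> k + 1" for l
    using deg degq by (auto simp: coeff_pCons split: nat.splits)
  ultimately have degH: "degree (coeff H l) \<le> j * 2 + (k + 1)" for l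
    unfolding H_def by (rule degree_coeff_mult_le)
  have 3: "degree (coeff H l) \<le> c + 1" for l
    using degH[of l] c by linarith
  have "bipoly_eval \<phi> \<eta> T H = \<eta> ^ (c + 1) * bipoly_eval \<phi> (1 / \<eta>) (- (T + (1 - \<eta>)\<^sup>2) / \<eta>\<^sup>2) H"
    if "\<eta> \<noteq> 0" "\<eta> \<noteq> 1" for \<eta> T
  proof -
    interpret \<phi>: unital_ring_hom \<phi> by (rule hom)
    have ev: "bipoly_eval \<phi> a b H = (b * (b + (1 - a)\<^sup>2)) ^ j * (\<phi>.poly_eval a f + b * \<phi>.poly_eval a q)" for a b
    proof -
      interpret e1: unital_ring_hom "\<phi>.poly_eval a" by (rule \<phi>.poly_eval_hom)
      interpret e2: unital_ring_hom "e1.poly_eval b" by (rule e1.poly_eval_hom)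
      have "\<phi>.poly_eval a w = (1 - a)\<^sup>2"
        by (simp add: w_def e1.simps \<phi>.poly_eval_pCons \<phi>.simps)
      then show ?thesis
        unfolding bipoly_eval_def H_def e2.mult e2.power S_def
        by (simp add: e1.poly_eval_pCons e1.poly_eval_0 e1.simps algebra_simps)
    qed
    interpret ea: unital_ring_hom "\<phi>.poly_eval \<eta>" by (rule \<phi>.poly_eval_hom)
    interpret eb: unital_ring_hom "\<phi>.poly_eval (1 / \<eta>)" by (rule \<phi>.poly_eval_hom)
    let ?fa = "\<phi>.poly_eval \<eta> f" and ?fb = "\<phi>.poly_eval (1 / \<eta>) f"
    let ?qa = "\<phi>.poly_eval \<eta> q" and ?qb = "\<phi>.poly_eval (1 / \<eta>) q"
    let ?ra = "\<phi>.poly_eval \<eta> (reflect (k + 1) f)" and ?rb = "\<phi>.poly_eval (1 / \<eta>) (reflect (k + 1) f)"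
    have ra: "?ra = \<eta> ^ (k + 1) * ?fb" and rb: "?rb = (1 / \<eta>) ^ (k + 1) * ?fa"
      using deg that by (auto intro!: \<phi>.poly_eval_reflect simp del: power_Suc)
    have qa: "?fa - ?ra = (1 - \<eta>)\<^sup>2 * ?qa"
      using arg_cong[OF q, of "\<phi>.poly_eval \<eta>"]
      by (simp add: ea.simps \<phi>.poly_eval_pCons \<phi>.simps)
    have qb: "?fb - ?rb = (1 - 1 / \<eta>)\<^sup>2 * ?qb"
      using arg_cong[OF q, of "\<phi>.poly_eval (1 / \<eta>)"]
      by (simp add: eb.simps \<phi>.poly_eval_pCons \<phi>.simps)
    have "\<eta> ^ (k + 1) * (?fb - ?rb) = ?ra - ?fa"
      unfolding ra rb right_diff_distrib using that by (simp add: power_divide)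
    then have "- ((1 - \<eta>)\<^sup>2 * ?qa) = \<eta> ^ (k + 1) * ((1 - 1 / \<eta>)\<^sup>2 * ?qb)"
      unfolding qa[symmetric] qb[symmetric] by simp
    also have "(1 - 1 / \<eta>)\<^sup>2 = (1 - \<eta>)\<^sup>2 / \<eta>\<^sup>2"
      using that by (simp add: field_simps power2_eq_square)
    finally have "(1 - \<eta>)\<^sup>2 * (- ?qa) = (1 - \<eta>)\<^sup>2 * (\<eta> ^ (k + 1) * (?qb / \<eta>\<^sup>2))"
      by (simp add: algebra_simps)
    moreover have "(1 - \<eta>)\<^sup>2 \<noteq> 0"
      using that by simp
    \<comment> \<open>Antisymmetry of q: reversing twice is the identity, so f minus its reversal
      changes sign. Dividing by (1 - \<eta>)^2 is where \<eta> = 1 has to be excluded.\<close>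
    ultimately have Q: "\<eta> ^ (k + 1) * (?qb / \<eta>\<^sup>2) = - ?qa"
      using mult_left_cancel[of "(1 - \<eta>)\<^sup>2"] by metis
    let ?T = "- (T + (1 - \<eta>)\<^sup>2) / \<eta>\<^sup>2"
    have "?T + (1 - 1 / \<eta>)\<^sup>2 = - T / \<eta>\<^sup>2"
      using that by (simp add: field_simps power2_eq_square)
    then have T: "?T * (?T + (1 - 1 / \<eta>)\<^sup>2) = T * (T + (1 - \<eta>)\<^sup>2) / \<eta> ^ 4"
      by (simp only: times_divide_times_eq minus_mult_minus mult.commute flip: power_add) simp
    have "\<eta> ^ (k + 1) * (?fb + ?T * ?qb) = ?ra - (T + (1 - \<eta>)\<^sup>2) * (\<eta> ^ (k + 1) * (?qb / \<eta>\<^sup>2))"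
      unfolding ra by (simp add: algebra_simps diff_divide_distrib add_divide_distrib)
    also have "\<dots> = ?fa + T * ?qa"
      unfolding Q using qa by (simp add: algebra_simps)
    finally have L: "\<eta> ^ (k + 1) * (?fb + ?T * ?qb) = ?fa + T * ?qa" .
    have gen: "\<eta> ^ (4 * j + k + 1) * (A ^ j * B) = (\<eta> ^ 4 * A) ^ j * (\<eta> ^ (k + 1) * B)" for A B
      by (simp add: power_add power_mult power_mult_distrib)
    have "\<eta> ^ (c + 1) * bipoly_eval \<phi> (1 / \<eta>) ?T H
        = (\<eta> ^ 4 * (?T * (?T + (1 - 1 / \<eta>)\<^sup>2))) ^ j * (\<eta> ^ (k + 1) * (?fb + ?T * ?qb))"
      unfolding ev c by (rule gen)
    also have "\<dots> = bipoly_eval \<phi> \<eta> T H"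
      unfolding ev L T using that by simp
    finally show ?thesis ..
  qed
  then have 4: "quasi_invariant \<phi> c H"
    unfolding quasi_invariant_def by blast
  from 1 2 3 4 show ?thesis by (rule that)
qed

text \<open>
  The multiples of \<open>(T (T + (1 - \<eta>)\<^sup>2))\<^sup>j\<close> only affect the coefficients of \<open>T\<^sup>l\<close> with \<open>l \<ge> j\<close>, so the divisibility
  conditions are met one after the other. In each step a linear condition at \<open>\<eta> = 1\<close> remains, which the free top
  coefficient of the new term satisfies.
\<close>

lemma quasi_invariant_exists:
  fixes \<phi> :: "'k::field_char_0 \<Rightarrow> 'r::field"
  assumes hom: "unital_ring_hom \<phi>" and c: "c \<ge> 1"
  shows "\<exists>H. coeff H 0 = monom (of_nat (c + 1)) c - monom (of_nat (c - 1)) (c + 1) \<and>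
    (\<forall>l. degree (coeff H l) \<le> c + 1) \<and>
    (\<forall>l\<le>J. monom 1 (c - 4 * l) dvd coeff H l) \<and>
    quasi_invariant \<phi> c H"
    (is "\<exists>H. ?P J H")
proof (induction J)
  case 0
  \<comment> \<open>This combination of \<eta>^c and \<eta>^(c+1) satisfies the derivative condition
    at 1: both sides equal 2 (c + 1). Its coefficient at \<eta>^c is nonzero and later yields the
    required monomial.\<close>
  let ?f = "monom (of_nat (c + 1)) c - monom (of_nat (c - 1)) (c + 1) :: 'k poly"
  have "degree ?f \<le> c + 1"
    by (intro degree_diff_le) (auto intro: order.trans[OF degree_monom_le])
  moreover have "2 * poly (pderiv ?f) 1 = of_nat (c + 1) * poly ?f 1"
    using c by (simp add: pderiv_diff pderiv_monom poly_monom of_nat_diff algebra_simps)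
  ultimately obtain H where H: "coeff H 0 = [:1, -1:] ^ (2 * 0) * ?f"
    "\<And>l. degree (coeff H l) \<le> c + 1"
    "quasi_invariant \<phi> c H"
    using quasi_invariant_term[OF hom, of c 0 c ?f] by auto
  have "monom 1 c dvd ?f"
    by (intro dvd_diff) (simp_all add: monom_1_dvd_iff')
  with H show ?case by (intro exI[of _ H]) simp
next
  case (Suc J)
  then obtain H where H: "?P J H" by blast
  let ?j = "Suc J"
  show ?case
  proof (cases "4 * ?j < c")
    \<comment> \<open>The exponent c - 4 (J + 1) is truncated to 0, so the new divisibility is
      trivial.\<close>
    case False
    then have "monom 1 (c - 4 * ?j) dvd coeff H ?j"
      by (simp add: monom_0 one_pCons[symmetric])
    with H show ?thesis by (intro exI[of _ H]) (auto simp: le_Suc_eq)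
  next
    case True
    define k where "k = c - 4 * ?j"
    have k: "c = 4 * ?j + k" using True by (simp add: k_def)
    let ?g = "[:1, -1:] ^ (2 * ?j) :: 'k poly"
    have "coeff ?g 0 \<noteq> 0" by (simp only: coeff_0_power) simp
    then obtain f0 where f0: "degree f0 \<le> k" "monom 1 k dvd coeff H ?j + ?g * f0"
      using solve_mod_monom by blast
    \<comment> \<open>Solving the derivative condition for f0 + B \<eta>^(k+1) gives this B; the
      division by k + 1 uses characteristic 0. The added term is a multiple of \<eta>^k and
      preserves the congruence just obtained.\<close>
    define B where "B = (of_nat (k + 1) * poly f0 1 - 2 * poly (pderiv f0) 1) / of_nat (k + 1)"
    have B: "of_nat (k + 1) * B = of_nat (k + 1) * poly f0 1 - 2 * poly (pderiv f0) 1"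
      unfolding B_def by (simp del: of_nat_Suc of_nat_add)
    define f where "f = f0 + monom B (k + 1)"
    have "degree f \<le> k + 1"
      unfolding f_def using f0 by (intro degree_add_le) (auto intro: order.trans[OF degree_monom_le])
    moreover have "2 * poly (pderiv f) 1 = of_nat (k + 1) * poly f 1"
    proof -
      have "poly f 1 = poly f0 1 + B" "poly (pderiv f) 1 = poly (pderiv f0) 1 + of_nat (k + 1) * B"
        by (simp_all add: f_def pderiv_add pderiv_monom poly_monom)
      then show ?thesis using B by (simp only: distrib_left) (simp add: algebra_simps)
    qed
    ultimately obtain H' where H': "\<And>l. l < ?j \<Longrightarrow> coeff H' l = 0" "coeff H' ?j = ?g * f"
      "\<And>l. degree (coeff H' l) \<le> c + 1"
      "quasi_invariant \<phi> c H'"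
      using quasi_invariant_term[OF hom k, of f] by blast
    have "monom 1 k dvd (coeff H ?j + ?g * f0) + ?g * monom B (k + 1)"
      by (intro dvd_add f0 dvd_mult) (simp add: monom_1_dvd_iff')
    then have "monom 1 (c - 4 * ?j) dvd coeff (H + H') ?j"
      by (simp add: H' f_def k_def algebra_simps)
    moreover have "monom 1 (c - 4 * l) dvd coeff (H + H') l" if "l \<le> J" for l
      using that H H'(1)[of l] by simp
    ultimately have "\<forall>l\<le>?j. monom 1 (c - 4 * l) dvd coeff (H + H') l"
      by (metis le_Suc_eq)
    moreover have "degree (coeff (H + H') l) \<le> c + 1" for l
      unfolding coeff_add using H H'(3) by (intro degree_add_le) blast+
    moreover have "quasi_invariant \<phi> c (H + H')"
      using H H'(4) by (intro quasi_invariant_add[OF hom]) blast+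
    moreover have "coeff (H + H') 0 = monom (of_nat (c + 1)) c - monom (of_nat (c - 1)) (c + 1)"
      using H H'(1)[of 0] by simp
    ultimately have "?P ?j (H + H')" by blast
    then show ?thesis by blast
  qed
qed

section \<open>Monomials of invariant polynomials\<close>

text \<open>Taylor expansion at \<eta> = 1 in X = \<eta> - 1. In power series \<eta> becomes
  invertible, while divisibility by powers of X still records the order of vanishing at x =
  y.\<close>

definition expand_at_1 :: "'k::field_char_0 poly \<Rightarrow> 'k fps" where
  "expand_at_1 p = fps_of_poly (pcompose p [:1, 1:])"

lemma unital_ring_hom_fps_const: "unital_ring_hom (fps_const :: 'k::comm_ring_1 \<Rightarrow> 'k fps)"
  by unfold_locales (simp_all flip: fps_const_add fps_const_mult)

lemma expand_at_1_hom: "unital_ring_hom (expand_at_1 :: 'k::field_char_0 poly \<Rightarrow> _)"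
  by unfold_locales (simp_all add: expand_at_1_def pcompose_1 pcompose_add pcompose_mult fps_of_poly_add fps_of_poly_mult)

lemma expand_at_1_conv_poly_eval:
  "expand_at_1 p = unital_ring_hom.poly_eval fps_const (1 + fps_X) p"
proof -
  interpret c: unital_ring_hom "fps_const :: 'a \<Rightarrow> 'a fps" by (rule unital_ring_hom_fps_const)
  show ?thesis
    by (induction p)
       (simp_all add: expand_at_1_def c.poly_eval_0 c.poly_eval_pCons pcompose_pCons
         fps_of_poly_add fps_of_poly_mult fps_of_poly_const fps_of_poly_pCons algebra_simps)
qed

lemma nth_1_plus_X_power: "fps_nth ((1 + fps_X) ^ n) (Suc 0) = (of_nat n :: 'k::comm_ring_1)"
proof (induction n)
  case (Suc n)
  have "fps_nth ((1 + fps_X) ^ n) 0 = (1 :: 'k)"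
    by (simp add: fps_nth_power_0)
  with Suc show ?case by (simp add: fps_mult_nth)
qed simp

text \<open>
  In the coordinate \<open>\<eta> = y/x = 1 + X\<close>, \<open>p l\<close> is the dehomogenised coefficient of \<open>z\<^sup>l\<close> in the part of weight \<open>d\<close>, and
  \<open>D l\<close> is its degree as a form in \<open>x, y\<close>.
\<close>

lemma graded_piece_bound:
  fixes p :: "nat \<Rightarrow> 'k::field_char_0 poly" and F G :: "'k fps poly" and d :: int
  defines "\<eta> \<equiv> 1 + fps_X :: 'k fps"
  assumes FG: "F = pcompose G [:- (inverse \<eta> ^ 5 * fps_X\<^sup>2), - inverse \<eta>:]"
    and F: "\<And>l. coeff F l = expand_at_1 (p l)"
    and G: "\<And>l. coeff G l = expand_at_1 (reflect (D l) (p l))"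
    and D: "\<And>l. degree (p l) \<le> D l" "\<And>l. p l \<noteq> 0 \<Longrightarrow> int (D l) = d + 7 * int l"
    and l: "p l \<noteq> 0"
  shows "d + 5 * int l \<ge> 0 \<and> (d + 5 * int l = 0 \<longrightarrow> l = 0)"
proof -
  interpret e: unital_ring_hom "expand_at_1 :: 'k poly \<Rightarrow> _" by (rule expand_at_1_hom)
  interpret c: unital_ring_hom "fps_const :: 'k \<Rightarrow> 'k fps" by (rule unital_ring_hom_fps_const)
  have unit: "\<eta> * inverse \<eta> = 1" "inverse \<eta> * \<eta> = 1"
    by (simp_all add: \<eta>_def inverse_mult_eq_1 inverse_mult_eq_1')
  define v where "v = (LEAST l. p l \<noteq> 0)"
  have v: "p v \<noteq> 0" "v \<le> l"
    unfolding v_def using LeastI[of "\<lambda>l. p l \<noteq> 0", OF l] Least_le[of "\<lambda>l. p l \<noteq> 0", OF l] by blast+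
  have below: "p i = 0" if "i < v" for i
    using not_less_Least[of i "\<lambda>l. p l \<noteq> 0"] that by (auto simp: v_def)
  define \<beta> where "\<beta> = - (inverse \<eta> ^ 5 * fps_X\<^sup>2)"
  have "inverse \<eta> \<noteq> 0"
    by (simp add: \<eta>_def)
  then have "\<beta> \<noteq> 0"
    by (simp add: \<beta>_def)
  moreover have "- inverse \<eta> * - \<eta> = 1"
    using unit by simp
  moreover have "reflect N 0 = (0 :: 'k poly)" for N
    by (simp add: reflect_def)
  ultimately obtain g r where gr: "coeff F v = \<beta> ^ v * g"
      "(- (- inverse \<eta>)) ^ v * coeff G v = \<beta> ^ v * (g + \<beta> * r)"
    using affine_pcompose_lowest_coeff[OF FG[folded \<beta>_def], of "- \<eta>" v] below
    by (auto simp: F G e.zero)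
  define P where "P = pcompose (p v) [:1, 1:]"
  have \<beta>_dvd: "fps_X ^ (2 * n) dvd \<beta> ^ n" for n
    unfolding power_mult by (rule dvd_power_same) (simp add: \<beta>_def)
  \<comment> \<open>\<beta> carries the factor X^2 of the tangency, so the lowest coefficient is
    divisible by (\<eta> - 1)^(2v); its degree is at most d + 7 v.\<close>
  have "fps_X ^ (2 * v) dvd fps_of_poly P"
    unfolding P_def expand_at_1_def[symmetric] F[symmetric] gr
    by (intro dvd_mult2 \<beta>_dvd)
  then obtain s where s: "fps_of_poly P = fps_X ^ (2 * v) * s" by (elim dvdE)
  have "coeff P i = 0" if "i < 2 * v" for i
    using arg_cong[OF s, of "\<lambda>f. fps_nth f i"] that by (simp add: fps_X_power_mult_nth)
  then have "monom 1 (2 * v) dvd P"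
    by (simp add: monom_1_dvd_iff')
  then obtain q where q: "P = monom 1 (2 * v) * q" by (elim dvdE)
  have "P \<noteq> 0"
    using v by (simp add: P_def pcompose_eq_0_iff)
  with q have "q \<noteq> 0" by auto
  have degP: "degree P = degree (p v)"
    by (simp add: P_def degree_pcompose)
  have "degree P = 2 * v + degree q"
    unfolding q using \<open>q \<noteq> 0\<close> by (simp add: degree_mult_eq degree_monom_eq)
  with degP D(1)[of v] have deg: "2 * v + degree q \<le> D v" by simp
  with D(2)[OF v(1)] have ge: "d + 5 * int v \<ge> 0" by linarith
  have "v = 0" if "d + 5 * int v = 0"
  proof -
    \<comment> \<open>Equality leaves no room for a cofactor: the lowest coefficient is a constant
      times (\<eta> - 1)^(2v).\<close>
    have Dv: "D v = 2 * v" and "degree q = 0"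
      using deg that D(2)[OF v(1)] by linarith+
    then obtain k where k: "q = [:k:]" by (auto elim: degree_eq_zeroE)
    with \<open>q \<noteq> 0\<close> have "k \<noteq> 0" by simp
    have "p v = pcompose P [:-1, 1:]"
      by (simp add: P_def pcompose_pCons flip: pcompose_assoc)
    also have "\<dots> = [:-1, 1:] ^ (2 * v) * [:k:]"
      by (simp add: q k pcompose_mult monom_altdef pcompose_smult pcompose_power pcompose_pCons)
    finally have pv: "p v = [:-1, 1:] ^ (2 * v) * [:k:]" .
    have ev: "c.poly_eval a (p v) = (a - 1) ^ (2 * v) * fps_const k" for a
    proof -
      interpret ev: unital_ring_hom "c.poly_eval a" by (rule c.poly_eval_hom)
      show ?thesis
        unfolding pv ev.mult ev.power by (simp add: c.poly_eval_pCons c.poly_eval_0 flip: fps_const_neg)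
    qed
    have Fv: "coeff F v = fps_X ^ (2 * v) * fps_const k"
      unfolding F expand_at_1_conv_poly_eval ev by simp
    have "coeff G v = \<eta> ^ (2 * v) * ((inverse \<eta> - 1) ^ (2 * v) * fps_const k)"
      unfolding G expand_at_1_conv_poly_eval \<eta>_def[symmetric] Dv ev[symmetric]
      using D(1)[of v] Dv unit by (intro c.poly_eval_reflect) auto
    also have "\<dots> = (\<eta> * (inverse \<eta> - 1)) ^ (2 * v) * fps_const k"
      by (simp only: power_mult_distrib mult.assoc)
    also have "\<eta> * (inverse \<eta> - 1) = - fps_X"
      using unit by (simp add: right_diff_distrib) (simp add: \<eta>_def)
    \<comment> \<open>The sign disappears because the exponent 2 v is even.\<close>
    finally have Gv: "coeff G v = fps_X ^ (2 * v) * fps_const k"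
      by simp
    have "inverse \<eta> ^ v * coeff G v = coeff F v + \<beta> ^ Suc v * r"
      using gr by (simp add: algebra_simps)
    then have "\<eta> ^ v * (inverse \<eta> ^ v * coeff G v) = \<eta> ^ v * (coeff F v + \<beta> ^ Suc v * r)"
      by simp
    also have "\<eta> ^ v * (inverse \<eta> ^ v * coeff G v) = coeff G v"
      using unit by (simp flip: mult.assoc power_mult_distrib)
    finally have "fps_X ^ (2 * v) * (fps_const k * (1 - \<eta> ^ v)) = \<beta> ^ Suc v * (\<eta> ^ v * r)"
      unfolding Fv Gv by (simp add: algebra_simps)
    moreover obtain t where "\<beta> ^ Suc v = fps_X ^ (2 * Suc v) * t"
      using \<beta>_dvd[of "Suc v"] by (elim dvdE)
    ultimately have "fps_X ^ (2 * v) * (fps_const k * (1 - \<eta> ^ v)) = fps_X ^ (2 * v) * (fps_X\<^sup>2 * (t * (\<eta> ^ v * r)))"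
      by (simp add: power_add power2_eq_square mult_ac)
    then have "fps_const k * (1 - \<eta> ^ v) = fps_X\<^sup>2 * (t * (\<eta> ^ v * r))"
      by simp
    \<comment> \<open>The coefficient of X in 1 - (1 + X)^v is -v, whereas the right-hand side
      starts at X^2.\<close>
    from arg_cong[OF this, of "\<lambda>f. fps_nth f (Suc 0)"] have "k * of_nat v = 0"
      by (simp add: fps_X_power_mult_nth \<eta>_def nth_1_plus_X_power)
    with \<open>k \<noteq> 0\<close> show ?thesis by simp
  qed
  \<comment> \<open>The bound passes from v to l since v \<le> l; equality at l forces v = l, and
    then l = 0.\<close>
  with ge v(2) show ?thesis by auto
qed

section \<open>The involution\<close>

definition mvar :: "nat \<Rightarrow> 'k::field mpoly_type" where
  "mvar i = Poly_Mapping.single (Poly_Mapping.single i 1) 1"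

definition embed :: "'k::field mpoly_type \<Rightarrow> 'k ratfun_type" where
  "embed p = Fract p 1"

definition cst :: "'k::field \<Rightarrow> 'k ratfun_type" where
  "cst c = embed (Poly_Mapping.single 0 c)"

definition rvar :: "nat \<Rightarrow> 'k::field ratfun_type" where
  "rvar i = embed (mvar i)"

lemma embed_hom: "unital_ring_hom (embed :: 'k::field mpoly_type \<Rightarrow> _)"
  by unfold_locales (simp_all add: embed_def One_fract_def)

lemma embed_eq_iff [simp]: "embed p = embed q \<longleftrightarrow> p = q"
  by (simp add: embed_def eq_fract)

lemma embed_eq_0_iff [simp]: "embed p = 0 \<longleftrightarrow> p = 0"
  using embed_eq_iff[of p 0] unital_ring_hom.zero[OF embed_hom] by metis

lemma Fract_eq_embed_divide: "Fract p q = embed p / embed q"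
  by (simp add: embed_def)

lemma cst_hom: "unital_ring_hom (cst :: 'k::field \<Rightarrow> _)"
proof -
  interpret unital_ring_hom "embed :: 'k mpoly_type \<Rightarrow> _" by (rule embed_hom)
  show ?thesis
    by unfold_locales (simp_all add: cst_def single_add one mult_single flip: add mult)
qed

interpretation embed: unital_ring_hom "embed :: 'k::field mpoly_type \<Rightarrow> _" by (rule embed_hom)
interpretation cst: unital_ring_hom "cst :: 'k::field \<Rightarrow> _" by (rule cst_hom)

lemma mvar_neq_0 [simp]: "mvar i \<noteq> (0 :: 'k::field mpoly_type)"
proof
  assume "mvar i = (0 :: 'k mpoly_type)"
  then have "Poly_Mapping.lookup (mvar i :: 'k mpoly_type) (Poly_Mapping.single i 1) = 0" by simp
  then show False by (simp add: mvar_def)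
qed

lemma mvar_eq_iff [simp]: "mvar i = (mvar j :: 'k::field mpoly_type) \<longleftrightarrow> i = j"
proof
  assume "mvar i = (mvar j :: 'k mpoly_type)"
  then have "Poly_Mapping.keys (mvar i :: 'k mpoly_type) = Poly_Mapping.keys (mvar j :: 'k mpoly_type)"
    by simp
  then have "Poly_Mapping.single i (1::nat) = Poly_Mapping.single j 1"
    by (simp add: mvar_def)
  then have "Poly_Mapping.keys (Poly_Mapping.single i (1::nat)) = Poly_Mapping.keys (Poly_Mapping.single j (1::nat))"
    by simp
  then show "i = j" by simp
qed simp

lemma rvar_neq_0 [simp]: "rvar i \<noteq> 0"
  by (simp add: rvar_def)

lemma rvar_eq_iff [simp]: "rvar i = (rvar j :: 'k::field ratfun_type) \<longleftrightarrow> i = j"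
  by (simp add: rvar_def)

lemma mpoly_eval_rvar: "mpoly_eval cst rvar p = embed p"
proof -
  interpret e: unital_ring_hom "mpoly_eval cst rvar :: 'a mpoly_type \<Rightarrow> _" by (rule cst.mpoly_eval_hom)
  show ?thesis
    by (induction p rule: mpoly_induct)
       (simp_all add: e.simps embed.simps, simp_all add: cst_def rvar_def mvar_def embed.one)
qed

text \<open>
  The values \<open>v'\<close> are the images of the variables under the involution, evaluated at the values \<open>v\<close>, with the
  denominator cleared so that the relation makes sense in any commutative ring.
\<close>

definition swapped :: "(nat \<Rightarrow> 'r::comm_ring_1) \<Rightarrow> (nat \<Rightarrow> 'r) \<Rightarrow> bool" where
  "swapped v v' \<longleftrightarrow> v' 0 = v 1 \<and> v' 1 = v 0 \<and> (\<forall>i>2. v' i = v i) \<and>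
     v 0 ^ 4 * v 1 ^ 5 * v' 2 = - (v 0 ^ 5 * v 1 ^ 4 * v 2 + (v 0 - v 1)\<^sup>2)"

text \<open>
  The same \<open>q\<close> serves for both rings, which transfers invariance in the function field to any other target.
\<close>

lemma swapped_common_denominator:
  fixes \<phi> :: "'k::field \<Rightarrow> 'r::comm_ring_1" and \<psi> :: "'k \<Rightarrow> 's::comm_ring_1"
  assumes \<phi>: "unital_ring_hom \<phi>" and \<psi>: "unital_ring_hom \<psi>"
    and v: "swapped v v'" and u: "swapped u u'"
  shows "\<exists>d q. mpoly_eval \<phi> v q = (v 0 * v 1) ^ d * mpoly_eval \<phi> v' p \<and>
               mpoly_eval \<psi> u q = (u 0 * u 1) ^ d * mpoly_eval \<psi> u' p"
    (is "\<exists>d q. ?P d q p")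
proof -
  interpret \<phi>: unital_ring_hom \<phi> by (rule \<phi>)
  interpret \<psi>: unital_ring_hom \<psi> by (rule \<psi>)
  interpret a: unital_ring_hom "mpoly_eval \<phi> v" by (rule \<phi>.mpoly_eval_hom)
  interpret a': unital_ring_hom "mpoly_eval \<phi> v'" by (rule \<phi>.mpoly_eval_hom)
  interpret b: unital_ring_hom "mpoly_eval \<psi> u" by (rule \<psi>.mpoly_eval_hom)
  interpret b': unital_ring_hom "mpoly_eval \<psi> u'" by (rule \<psi>.mpoly_eval_hom)
  have eval_mvar: "mpoly_eval \<phi> w (mvar i) = w i" "mpoly_eval \<psi> w' (mvar i) = w' i" for w w' i
    by (simp_all add: mvar_def \<phi>.one \<psi>.one)
  show ?thesis
  proof (induction p rule: mpoly_induct)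
    case (const c)
    have "?P 0 (Poly_Mapping.single 0 c) (Poly_Mapping.single 0 c)" by simp
    then show ?case by blast
  next
    case (var i)
    consider "i = 0" | "i = 1" | "i = 2" | "i > 2" by linarith
    then have "\<exists>d q. ?P d q (mvar i)"
    proof cases
      case 1
      then have "?P 0 (mvar 1) (mvar i)"
        using v u by (simp add: eval_mvar swapped_def)
      then show ?thesis by blast
    next
      case 2
      then have "?P 0 (mvar 0) (mvar i)"
        using v u by (simp add: eval_mvar swapped_def)
      then show ?thesis by blast
    next
      case 3
      \<comment> \<open>The denominator x^4 y^5 is completed to (x y)^5, hence the extra factor
        x.\<close>
      let ?q = "- (mvar 0 * (mvar 0 ^ 5 * mvar 1 ^ 4 * mvar 2 + (mvar 0 - mvar 1)\<^sup>2))"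
      have "(w 0 * w 1) ^ 5 * w' 2 = - (w 0 * (w 0 ^ 5 * w 1 ^ 4 * w 2 + (w 0 - w 1)\<^sup>2))"
        if "swapped w w'" for w w' :: "nat \<Rightarrow> 't::comm_ring_1"
      proof -
        have "(w 0 * w 1) ^ 5 * w' 2 = w 0 * (w 0 ^ 4 * w 1 ^ 5 * w' 2)"
          by (simp add: power_mult_distrib numeral_eq_Suc mult_ac)
        also have "w 0 ^ 4 * w 1 ^ 5 * w' 2 = - (w 0 ^ 5 * w 1 ^ 4 * w 2 + (w 0 - w 1)\<^sup>2)"
          using that unfolding swapped_def by blast
        finally show ?thesis by (simp only: mult_minus_right)
      qed
      from this[OF v] this[OF u] have "?P 5 ?q (mvar i)"
        by (simp add: 3 a.simps b.simps eval_mvar)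
      then show ?thesis by blast
    next
      case 4
      then have "?P 0 (mvar i) (mvar i)"
        using v u by (simp add: eval_mvar swapped_def)
      then show ?thesis by blast
    qed
    then show ?case by (simp add: mvar_def)
  next
    case (add p1 p2)
    then obtain d1 q1 d2 q2 where P: "?P d1 q1 p1" "?P d2 q2 p2" by blast
    let ?D = "mvar 0 * mvar 1"
    have "?P (d1 + d2) (q1 * ?D ^ d2 + q2 * ?D ^ d1) (p1 + p2)"
      using P by (simp add: a.simps b.simps a'.simps b'.simps eval_mvar power_add algebra_simps)
    then show ?case by blast
  next
    case (mult p1 p2)
    then obtain d1 q1 d2 q2 where P: "?P d1 q1 p1" "?P d2 q2 p2" by blast
    have "?P (d1 + d2) (q1 * q2) (p1 * p2)"
      using P by (simp add: a.simps b.simps a'.simps b'.simps power_add mult_ac)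
    then show ?case by blast
  qed
qed

section \<open>The involution on the function field\<close>

definition tau_var :: "nat \<Rightarrow> 'k::field ratfun_type" where
  "tau_var i = (if i = 0 then rvar 1 else if i = 1 then rvar 0
     else if i = 2 then - (rvar 0 ^ 5 * rvar 1 ^ 4 * rvar 2 + (rvar 0 - rvar 1)\<^sup>2) / (rvar 0 ^ 4 * rvar 1 ^ 5)
     else rvar i)"

definition tau_poly :: "'k::field mpoly_type \<Rightarrow> 'k ratfun_type" where
  "tau_poly = mpoly_eval cst tau_var"

interpretation tau_poly: unital_ring_hom "tau_poly :: 'k::field mpoly_type \<Rightarrow> _"
  unfolding tau_poly_def by (rule cst.mpoly_eval_hom)

lemma swapped_rvar: "swapped rvar (tau_var :: nat \<Rightarrow> 'k::field ratfun_type)"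
  by (simp add: swapped_def tau_var_def)

text \<open>With z' the image of z, the relation x^4 y^5 z' + x^5 y^4 z + (x - y)^2 = 0 is symmetric
  under exchanging x with y and z with z'. This is why the map is an involution.\<close>

lemma swapped_tau_var: "swapped (tau_var :: nat \<Rightarrow> 'k::field ratfun_type) rvar"
proof -
  let ?x = "rvar 0 :: 'k ratfun_type" and ?y = "rvar 1 :: 'k ratfun_type" and ?z = "rvar 2 :: 'k ratfun_type"
  have "tau_var 0 ^ 5 * tau_var 1 ^ 4 * tau_var 2 = - (?x ^ 5 * ?y ^ 4 * ?z + (?x - ?y)\<^sup>2)"
    by (simp add: tau_var_def)
  then have "?y ^ 4 * ?x ^ 5 * ?z = - (tau_var 0 ^ 5 * tau_var 1 ^ 4 * tau_var 2 + (?y - ?x)\<^sup>2)"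
    by (simp add: algebra_simps power2_eq_square)
  then show ?thesis
    by (simp add: swapped_def tau_var_def)
qed

text \<open>A power of x y times the image of p is a polynomial q, and by symmetry the image of q is
  a nonzero multiple of p. Injectivity is what allows the extension to fractions.\<close>

lemma tau_poly_eq_0_iff [simp]: "tau_poly p = 0 \<longleftrightarrow> p = 0"
proof
  assume *: "tau_poly p = 0"
  obtain d q where q: "embed q = (rvar 0 * rvar 1) ^ d * tau_poly p"
      "tau_poly q = (tau_var 0 * tau_var 1) ^ d * embed p"
    using swapped_common_denominator[OF cst_hom cst_hom swapped_rvar swapped_tau_var, of p]
    unfolding mpoly_eval_rvar tau_poly_def[symmetric] by blast
  with * have "q = 0" by simp
  with q(2) have "(tau_var 0 * tau_var 1) ^ d * embed p = 0"
    by (simp add: tau_poly.zero)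
  then show "p = 0" by (simp add: tau_var_def)
qed (simp add: tau_poly.zero)

text \<open>Any representation as a fraction may be chosen; \<open>tau_Fract\<close> shows that the
  value does not depend on it.\<close>

definition tau :: "'k::field ratfun_type \<Rightarrow> 'k ratfun_type" where
  "tau f = (SOME g. \<exists>p q. q \<noteq> 0 \<and> f = Fract p q \<and> g = tau_poly p / tau_poly q)"

lemma tau_Fract:
  assumes "q \<noteq> 0"
  shows "tau (Fract p q) = tau_poly p / tau_poly q"
  unfolding tau_def
proof (rule some_equality)
  show "\<exists>p' q'. q' \<noteq> 0 \<and> Fract p q = Fract p' q' \<and> tau_poly p / tau_poly q = tau_poly p' / tau_poly q'"
    using assms by blast
next
  fix g assume "\<exists>p' q'. q' \<noteq> 0 \<and> Fract p q = Fract p' q' \<and> g = tau_poly p' / tau_poly q'"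
  then obtain p' q' where q': "q' \<noteq> 0" "p * q' = p' * q" "g = tau_poly p' / tau_poly q'"
    using assms by (auto simp: eq_fract)
  from q'(2) have "tau_poly p * tau_poly q' = tau_poly p' * tau_poly q"
    by (simp flip: tau_poly.mult)
  with q' assms show "g = tau_poly p / tau_poly q"
    by (simp add: frac_eq_eq)
qed

lemma tau_embed: "tau (embed p) = tau_poly p"
  by (simp add: embed_def tau_Fract tau_poly.one)

lemma tau_hom: "unital_ring_hom (tau :: 'k::field ratfun_type \<Rightarrow> _)"
proof
  show "tau 1 = (1 :: 'k ratfun_type)"
    by (simp add: One_fract_def tau_Fract tau_poly.one)
next
  fix f g :: "'k ratfun_type"
  obtain p q where f: "f = Fract p q" "q \<noteq> 0" by (cases f)
  obtain p' q' where g: "g = Fract p' q'" "q' \<noteq> 0" by (cases g)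
  show "tau (f + g) = tau f + tau g"
    using f g by (simp add: tau_Fract tau_poly.simps add_frac_eq)
  show "tau (f * g) = tau f * tau g"
    using f g by (simp add: tau_Fract tau_poly.simps)
qed

interpretation tau: unital_ring_hom "tau :: 'k::field ratfun_type \<Rightarrow> _" by (rule tau_hom)

lemma tau_inverse: "tau (inverse f) = inverse (tau f)"
proof (cases "f = 0")
  case False
  then have "tau f * tau (inverse f) = 1"
    by (simp add: tau.one flip: tau.mult)
  then show ?thesis by (metis inverse_unique)
qed (simp add: tau.zero)

lemma tau_divide: "tau (f / g) = tau f / tau g"
  by (simp add: divide_inverse tau.mult tau_inverse)

lemma tau_cst [simp]: "tau (cst c) = cst c"
  by (simp add: cst_def tau_embed) (simp add: tau_poly_def cst_def)

lemma tau_rvar: "tau (rvar i) = tau_var i"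
  by (simp add: rvar_def tau_embed mvar_def) (simp add: tau_poly_def cst.one)

text \<open>Only z needs work: applying \<open>tau\<close> to its defining relation and comparing
  with the mirrored relation leaves a nonzero factor to cancel.\<close>

lemma tau_tau_var: "tau (tau_var i) = rvar i"
proof -
  consider "i = 0" | "i = 1" | "i = 2" | "i > 2" by linarith
  then show ?thesis
  proof cases
    case 3
    have s: "rvar 0 ^ 4 * rvar 1 ^ 5 * tau_var 2 = - (rvar 0 ^ 5 * rvar 1 ^ 4 * rvar 2 + (rvar 0 - rvar 1 :: 'a ratfun_type)\<^sup>2)"
      using swapped_rvar[where 'k='a] unfolding swapped_def by blast
    have t: "tau_var 0 ^ 4 * tau_var 1 ^ 5 * rvar 2 = - (tau_var 0 ^ 5 * tau_var 1 ^ 4 * tau_var 2 + (tau_var 0 - tau_var 1 :: 'a ratfun_type)\<^sup>2)"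
      using swapped_tau_var[where 'k='a] unfolding swapped_def by blast
    have "tau_var 0 ^ 4 * tau_var 1 ^ 5 * tau (tau_var 2) = (tau_var 0 ^ 4 * tau_var 1 ^ 5 * rvar 2 :: 'a ratfun_type)"
      using arg_cong[OF s, of tau] unfolding t by (simp add: tau.simps tau_rvar)
    then show ?thesis
      by (simp add: 3) (simp add: tau_var_def)
  qed (simp_all add: tau_var_def tau_rvar)
qed

lemma tau_tau [simp]: "tau (tau f) = f"
proof -
  have poly: "tau (tau_poly p) = embed p" for p :: "'a mpoly_type"
    by (simp add: tau_poly_def tau.comp_mpoly_eval tau_tau_var mpoly_eval_rvar)
  obtain p q where "f = Fract p q" "q \<noteq> 0" by (cases f)
  then show ?thesis
    by (simp add: tau_Fract tau_divide poly tau_embed Fract_eq_embed_divide)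
qed

section \<open>Weights and homogeneous components\<close>

lemma reflect_monom:
  assumes "n \<le> N"
  shows "reflect N (monom c n) = monom c (N - n)"
proof -
  have "reflect N (monom c n) = (\<Sum>i\<in>{n}. monom (coeff (monom c n) i) (N - i))"
    unfolding reflect_def using assms by (intro sum.mono_neutral_right) auto
  then show ?thesis by simp
qed

lemma reflect_sum: "reflect N (sum f A) = (\<Sum>a\<in>A. reflect N (f a))"
  for f :: "'a \<Rightarrow> 'b::comm_ring_1 poly"
proof -
  have add: "reflect N (p + q) = reflect N p + reflect N q" for p q :: "'b poly"
    by (simp add: reflect_def sum.distrib flip: add_monom)
  have zero: "reflect N 0 = (0 :: 'b poly)"
    by (simp add: reflect_def)
  show ?thesis
    by (induction A rule: infinite_finite_induct) (auto simp: zero add)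
qed

lemma single_power_int: "Poly_Mapping.single (a::int) b ^ n = Poly_Mapping.single (int n * a) (b ^ n)"
  by (induction n) (simp_all add: mult_single algebra_simps)

text \<open>The substitution \<open>x = s\<close>, \<open>y = \<eta> s\<close>, \<open>z = \<zeta> / s\<^sup>7\<close> turns the grading for which the involution is
  homogeneous into the degree in \<open>s\<close>.\<close>

definition homogeneous_point :: "(nat \<Rightarrow> 'a) \<Rightarrow> nat \<Rightarrow> int \<Rightarrow>\<^sub>0 'a::comm_ring_1" where
  "homogeneous_point r i = (if i < 3 then Poly_Mapping.single (if i = 2 then -7 else 1) (r i) else 0)"

text \<open>Sending the variables beyond the third to 0 discards all monomials that contain them.
  Laurent polynomials in s appear because z has negative weight; the exponent of s is the weight of
  the monomial.\<close>

lemma monomial_eval_homogeneous_point: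
  "monomial_eval (homogeneous_point r) m = (if Poly_Mapping.keys m \<subseteq> {..<3} then
     Poly_Mapping.single (int (Poly_Mapping.lookup m 0) + int (Poly_Mapping.lookup m 1) - 7 * int (Poly_Mapping.lookup m 2))
       (r 0 ^ Poly_Mapping.lookup m 0 * r 1 ^ Poly_Mapping.lookup m 1 * r 2 ^ Poly_Mapping.lookup m 2) else 0)"
proof (cases "Poly_Mapping.keys m \<subseteq> {..<3}")
  case True
  have "monomial_eval (homogeneous_point r) m = (\<Prod>i\<in>{..<3}. homogeneous_point r i ^ Poly_Mapping.lookup m i)"
    by (rule monomial_eval_superset) (use True in auto)
  then show ?thesis
    using True by (simp add: eval_nat_numeral homogeneous_point_def single_power_int mult_single algebra_simps)
next
  case False
  then obtain i where "i \<in> Poly_Mapping.keys m" "i \<ge> 3" by force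
  then have "monomial_eval (homogeneous_point r) m = 0"
    unfolding monomial_eval_def
    by (intro prod_zero bexI[of _ i]) (auto simp: homogeneous_point_def in_keys_iff zero_power)
  with False show ?thesis by simp
qed

definition graded_keys :: "'k::zero mpoly_type \<Rightarrow> int \<Rightarrow> (nat \<Rightarrow>\<^sub>0 nat) set" where
  "graded_keys p d = {m \<in> Poly_Mapping.keys p. Poly_Mapping.keys m \<subseteq> {..<3} \<and>
     int (Poly_Mapping.lookup m 0) + int (Poly_Mapping.lookup m 1) - 7 * int (Poly_Mapping.lookup m 2) = d}"

lemma lookup_mpoly_eval_homogeneous_point:
  assumes "unital_ring_hom \<phi>"
  shows "Poly_Mapping.lookup (mpoly_eval (\<lambda>c. Poly_Mapping.single 0 (\<phi> c)) (homogeneous_point r) p) d =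
    (\<Sum>m\<in>graded_keys p d. \<phi> (Poly_Mapping.lookup p m) *
      (r 0 ^ Poly_Mapping.lookup m 0 * r 1 ^ Poly_Mapping.lookup m 1 * r 2 ^ Poly_Mapping.lookup m 2))"
proof -
  have "Poly_Mapping.lookup (mpoly_eval (\<lambda>c. Poly_Mapping.single 0 (\<phi> c)) (homogeneous_point r) p) d =
    (\<Sum>m\<in>Poly_Mapping.keys p. Poly_Mapping.lookup
      (Poly_Mapping.single 0 (\<phi> (Poly_Mapping.lookup p m)) * monomial_eval (homogeneous_point r) m) d)"
    by (simp add: mpoly_eval_def lookup_sum)
  also have "\<dots> = (\<Sum>m\<in>graded_keys p d. Poly_Mapping.lookup
      (Poly_Mapping.single 0 (\<phi> (Poly_Mapping.lookup p m)) * monomial_eval (homogeneous_point r) m) d)"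
    by (rule sum.mono_neutral_right)
       (auto simp: graded_keys_def monomial_eval_homogeneous_point mult_single lookup_single when_def)
  also have "\<dots> = (\<Sum>m\<in>graded_keys p d. \<phi> (Poly_Mapping.lookup p m) *
      (r 0 ^ Poly_Mapping.lookup m 0 * r 1 ^ Poly_Mapping.lookup m 1 * r 2 ^ Poly_Mapping.lookup m 2))"
    by (rule sum.cong)
       (auto simp: graded_keys_def monomial_eval_homogeneous_point mult_single lookup_single)
  finally show ?thesis .
qed

text \<open>Invariance is evaluated at the homogeneous point and compared in the weight d = i - 7 l
  of the monomial m. This gives two polynomials in \<zeta> over power series, to which
  \<open>graded_piece_bound\<close> applies; d + 5 l is i - 2 l.\<close>

lemma tau_invariant_monomials:
  fixes p :: "'k::field_char_0 mpoly_type"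
  assumes inv: "tau (embed p) = embed p"
    and m: "m \<in> Poly_Mapping.keys p" "Poly_Mapping.keys m \<subseteq> {..<3}"
  defines "i \<equiv> Poly_Mapping.lookup m 0 + Poly_Mapping.lookup m 1" and "l \<equiv> Poly_Mapping.lookup m 2"
  shows "2 * l \<le> i \<and> (i = 2 * l \<longrightarrow> l = 0)"
proof -
  define \<eta> :: "'k fps" where "\<eta> = 1 + fps_X"
  have unit: "\<eta> * inverse \<eta> = 1" "inverse \<eta> * \<eta> = 1"
    by (simp_all add: \<eta>_def inverse_mult_eq_1 inverse_mult_eq_1')
  \<comment> \<open>The image of z at x = 1, y = \<eta>, z = \<zeta>, namely -(\<eta>^4 \<zeta> + (1
    - \<eta>)^2) / \<eta>^5 with 1 - \<eta> = -X.\<close>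
  define q :: "'k fps poly" where "q = [:- (inverse \<eta> ^ 5 * fps_X\<^sup>2), - inverse \<eta>:]"
  define \<phi> :: "'k \<Rightarrow> 'k fps poly" where "\<phi> c = [:fps_const c:]" for c
  define r :: "nat \<Rightarrow> 'k fps poly" where "r i = (if i = 0 then 1 else if i = 1 then [:\<eta>:] else [:0, 1:])" for i
  define r' :: "nat \<Rightarrow> 'k fps poly" where "r' i = (if i = 0 then [:\<eta>:] else if i = 1 then 1 else q)" for i
  define \<Phi> :: "'k \<Rightarrow> int \<Rightarrow>\<^sub>0 'k fps poly" where "\<Phi> = (\<lambda>c. Poly_Mapping.single 0 (\<phi> c))"
  let ?v = "homogeneous_point r" and ?v' = "homogeneous_point r'"
  have \<phi>: "unital_ring_hom \<phi>"
    unfolding \<phi>_def by unfold_locales (simp_all flip: fps_const_add fps_const_mult)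
  have \<Phi>: "unital_ring_hom \<Phi>"
    unfolding \<Phi>_def
    by unfold_locales (simp_all add: mult_single single_add unital_ring_hom.simps[OF \<phi>])
  interpret \<Phi>: unital_ring_hom \<Phi> by (rule \<Phi>)
  interpret ev: unital_ring_hom "mpoly_eval \<Phi> ?v" by (rule \<Phi>.mpoly_eval_hom)
  have swapped: "swapped ?v ?v'"
  proof -
    have "[:\<eta>:] ^ 5 * q = - ([:\<eta>:] ^ 4 * [:0, 1:] + (1 - [:\<eta>:])\<^sup>2)"
    proof -
      have "\<eta> ^ 5 * inverse \<eta> ^ 5 = 1"
        using unit by (simp flip: power_mult_distrib)
      moreover have "\<eta> ^ 5 * inverse \<eta> = \<eta> ^ 4 * (\<eta> * inverse \<eta>)"
        by (simp add: eval_nat_numeral mult_ac)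
      ultimately have "smult (\<eta> ^ 5) q = [:- fps_X\<^sup>2, - (\<eta> ^ 4):]"
        using unit by (simp add: q_def flip: mult.assoc)
      moreover have "[:\<eta>:] ^ n = [:\<eta> ^ n:]" for n
        by (simp add: poly_const_pow)
      moreover have "(1 - [:\<eta>:])\<^sup>2 = [:fps_X\<^sup>2:]"
        by (simp add: \<eta>_def one_pCons power2_eq_square)
      ultimately show ?thesis by simp
    qed
    then show ?thesis
      by (simp add: swapped_def homogeneous_point_def r_def r'_def single_power_int mult_single power2_eq_square
          flip: single_add single_diff single_uminus)
  qed
  have cancel: "a = b" if "w * a = w * b" "u * w = 1" for a b u w :: "int \<Rightarrow>\<^sub>0 'k fps poly"
  proof -
    have "u * w * a = u * w * b" using that(1) by (simp only: mult.assoc)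
    with that(2) show ?thesis by simp
  qed
  have eq: "mpoly_eval \<Phi> ?v p = mpoly_eval \<Phi> ?v' p"
  proof -
    obtain d P where P: "embed P = (rvar 0 * rvar 1) ^ d * tau_poly p"
        "mpoly_eval \<Phi> ?v P = (?v 0 * ?v 1) ^ d * mpoly_eval \<Phi> ?v' p"
      using swapped_common_denominator[OF cst_hom \<Phi> swapped_rvar swapped, of p]
      unfolding mpoly_eval_rvar tau_poly_def[symmetric] by blast
    have "embed P = embed ((mvar 0 * mvar 1) ^ d * p)"
      using P(1) inv by (simp add: tau_embed embed.mult embed.power rvar_def)
    then have "P = (mvar 0 * mvar 1) ^ d * p" by simp
    with P(2) have "(?v 0 * ?v 1) ^ d * mpoly_eval \<Phi> ?v p = (?v 0 * ?v 1) ^ d * mpoly_eval \<Phi> ?v' p"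
      by (simp add: ev.mult ev.power) (simp add: mvar_def \<Phi>.one)
    \<comment> \<open>At this point x y = \<eta> s^2 is a unit, so the common denominator can be
      cancelled.\<close>
    moreover have "Poly_Mapping.single (-2) [:inverse \<eta>:] * (?v 0 * ?v 1) = 1"
      using unit by (simp add: homogeneous_point_def r_def mult_single flip: one_pCons)
    then have "Poly_Mapping.single (-2) [:inverse \<eta>:] ^ d * (?v 0 * ?v 1) ^ d = 1"
      by (simp flip: power_mult_distrib)
    ultimately show ?thesis
      using cancel by blast
  qed
  define d where "d = int i - 7 * int l"
  let ?K = "graded_keys p d"
  let ?L = "Poly_Mapping.lookup"
  have fin: "finite ?K" by (simp add: graded_keys_def)
  \<comment> \<open>F is the component of weight d at (1, \<eta>, \<zeta>), and G the one at
    (\<eta>, 1, \<zeta>).\<close>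
  define F where "F = (\<Sum>m\<in>?K. monom (fps_const (?L p m) * \<eta> ^ ?L m 1) (?L m 2))"
  define G where "G = (\<Sum>m\<in>?K. monom (fps_const (?L p m) * \<eta> ^ ?L m 0) (?L m 2))"
  have monom: "monom (fps_const c * \<eta> ^ a) b = \<phi> c * ([:\<eta>:] ^ a * [:0, 1:] ^ b)" for c a b
    by (simp add: \<phi>_def monom_altdef poly_const_pow mult.commute)
  have F: "F = ?L (mpoly_eval \<Phi> ?v p) d"
    unfolding \<Phi>_def lookup_mpoly_eval_homogeneous_point[OF \<phi>] F_def monom by (simp add: r_def)
  have G: "pcompose G q = ?L (mpoly_eval \<Phi> ?v' p) d"
    unfolding \<Phi>_def lookup_mpoly_eval_homogeneous_point[OF \<phi>] G_def monom pcompose_sum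
    by (simp add: r'_def pcompose_mult pcompose_power \<phi>_def pcompose_pCons pcompose_smult)
  have FG: "F = pcompose G q"
    unfolding F G eq ..
  define P where "P n = (\<Sum>m\<in>{m\<in>?K. ?L m 2 = n}. monom (?L p m) (?L m 1))" for n
  define D where "D n = nat (d + 7 * int n)" for n
  have K: "int (?L m 0) + int (?L m 1) = d + 7 * int (?L m 2)" if "m \<in> ?K" for m
    using that by (auto simp: graded_keys_def)
  interpret e: unital_ring_hom "expand_at_1 :: 'k poly \<Rightarrow> _" by (rule expand_at_1_hom)
  interpret c: unital_ring_hom "fps_const :: 'k \<Rightarrow> 'k fps" by (rule unital_ring_hom_fps_const)
  have e_monom: "expand_at_1 (monom a n) = fps_const a * \<eta> ^ n" for a n
    by (simp add: expand_at_1_conv_poly_eval c.poly_eval_monom \<eta>_def)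
  have cF: "coeff F n = expand_at_1 (P n)" for n
    unfolding F_def P_def coeff_sum e.sum e_monom
    by (simp add: fin sum.inter_filter if_distrib cong: if_cong)
  have cG: "coeff G n = expand_at_1 (reflect (D n) (P n))" for n
  proof -
    have "reflect (D n) (P n) = (\<Sum>m\<in>{m\<in>?K. ?L m 2 = n}. monom (?L p m) (?L m 0))"
      unfolding P_def reflect_sum
    proof (rule sum.cong)
      fix m assume "m \<in> {m\<in>?K. ?L m 2 = n}"
      with K[of m] have "?L m 1 \<le> D n" "D n - ?L m 1 = ?L m 0" by (auto simp: D_def)
      then show "reflect (D n) (monom (?L p m) (?L m 1)) = monom (?L p m) (?L m 0)"
        by (simp add: reflect_monom)
    qed simp
    then show ?thesis
      unfolding G_def coeff_sum by (simp add: e.sum e.zero e_monom fin sum.inter_filter if_distrib cong: if_cong)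
  qed
  have deg: "degree (P n) \<le> D n" for n
    unfolding P_def
  proof (rule degree_sum_le)
    fix m assume "m \<in> {m\<in>?K. ?L m 2 = n}"
    with K[of m] have "?L m 1 \<le> D n" by (auto simp: D_def)
    then show "degree (monom (?L p m) (?L m 1)) \<le> D n"
      by (rule order.trans[OF degree_monom_le])
  qed (simp add: fin)
  have D: "int (D n) = d + 7 * int n" if "P n \<noteq> 0" for n
  proof -
    from that obtain m where "m \<in> ?K" "?L m 2 = n"
      unfolding P_def by (metis (mono_tags, lifting) mem_Collect_eq sum.neutral)
    with K[of m] show ?thesis by (simp add: D_def)
  qed
  have mK: "m \<in> ?K"
    using m by (simp add: graded_keys_def d_def i_def l_def)
  \<comment> \<open>Once the weight is fixed, the exponents of y and z determine that of x, so m is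
    the only monomial that contributes and no cancellation occurs.\<close>
  have "coeff (P l) (?L m 1) = (\<Sum>m'\<in>{m}. ?L p m')"
    unfolding P_def coeff_sum
  proof (rule sum.mono_neutral_cong_right)
    show "\<forall>m'\<in>{m'\<in>?K. ?L m' 2 = l} - {m}. coeff (monom (?L p m') (?L m' 1)) (?L m 1) = 0"
    proof
      fix m' assume m': "m' \<in> {m'\<in>?K. ?L m' 2 = l} - {m}"
      have "?L m' 1 \<noteq> ?L m 1"
      proof
        assume *: "?L m' 1 = ?L m 1"
        have "?L m' j = ?L m j" for j
        proof -
          have m'K: "m' \<in> ?K" and m'2: "?L m' 2 = ?L m 2"
            using m' by (simp_all add: l_def)
          have "int (?L m' 0) = int (?L m 0)"
            using K[OF m'K] K[OF mK] unfolding * m'2 by linarith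
          then have "?L m' 0 = ?L m 0" by simp
          moreover have "?L m' j = 0 \<and> ?L m j = 0" if "j \<ge> 3"
          proof -
            have "j \<notin> Poly_Mapping.keys m' \<and> j \<notin> Poly_Mapping.keys m"
              using that m'K mK unfolding graded_keys_def by fastforce
            then show ?thesis by (simp add: in_keys_iff)
          qed
          moreover have "j = 0 \<or> j = 1 \<or> j = 2 \<or> j \<ge> 3" by linarith
          ultimately show ?thesis
            using * m'2 by auto
        qed
        then have "m' = m" by (intro poly_mapping_eqI)
        with m' show False by simp
      qed
      then show "coeff (monom (?L p m') (?L m' 1)) (?L m 1) = 0" by simp
    qed
  qed (use fin mK in \<open>auto simp: l_def\<close>)
  then have "P l \<noteq> 0"
    using m(1) by (auto simp: in_keys_iff)
  from graded_piece_bound[OF FG[unfolded q_def \<eta>_def] cF cG deg D this]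
  have "d + 5 * int l \<ge> 0" "d + 5 * int l = 0 \<longrightarrow> l = 0" by auto
  then show ?thesis
    unfolding d_def by auto
qed

section \<open>Invariant polynomials of large slope\<close>

lemma (in unital_ring_hom) poly_eval_altdef:
  assumes "degree p \<le> n"
  shows "poly_eval a p = (\<Sum>i\<le>n. f (coeff p i) * a ^ i)"
proof -
  interpret e: unital_ring_hom "poly_eval a" by (rule poly_eval_hom)
  have "poly_eval a p = poly_eval a (\<Sum>i\<le>n. monom (coeff p i) i)"
    using assms by (simp add: poly_as_sum_of_monoms')
  then show ?thesis by (simp add: e.sum poly_eval_monom)
qed

lemma bipoly_eval_altdef:
  assumes "unital_ring_hom \<phi>" "\<And>l. degree (coeff H l) \<le> n"
  shows "bipoly_eval \<phi> a b H = (\<Sum>l\<le>degree H. \<Sum>i\<le>n. \<phi> (coeff (coeff H l) i) * a ^ i * b ^ l)"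
proof -
  interpret \<phi>: unital_ring_hom \<phi> by fact
  interpret e: unital_ring_hom "\<phi>.poly_eval a" by (rule \<phi>.poly_eval_hom)
  show ?thesis
    unfolding bipoly_eval_def e.poly_eval_altdef[OF order.refl] \<phi>.poly_eval_altdef[OF assms(2)]
    by (simp add: sum_distrib_right)
qed

lemma polys_in_diff: "p \<in> polys_in n \<Longrightarrow> q \<in> polys_in n \<Longrightarrow> p - q \<in> polys_in n"
  using polys_in_add[OF _ polys_in_uminus, of p n q] by simp

lemma polys_in_power: "p \<in> polys_in n \<Longrightarrow> p ^ k \<in> polys_in n"
  by (induction k) (auto intro: polys_in_1 polys_in_mult)

lemma polys_in_sum: "(\<And>a. a \<in> A \<Longrightarrow> f a \<in> polys_in n) \<Longrightarrow> sum f A \<in> polys_in n"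
  by (induction A rule: infinite_finite_induct) (auto intro: polys_in_0 polys_in_add)

lemma polys_in_mvar: "i < n \<Longrightarrow> mvar i \<in> polys_in n"
  by (auto simp: mvar_def polys_in_def)

text \<open>The substitution y = 0, with x as the inner and z as the outer variable, isolates the
  monomials in x and z alone.\<close>

lemma exists_key_of_coeff:
  fixes p :: "'k::field mpoly_type"
  defines "w \<equiv> (\<lambda>i. if i = 0 then [:[:0, 1:]:] else if i = 2 then [:0, 1:] else (0 :: 'k poly poly))"
  assumes "coeff (coeff (mpoly_eval (\<lambda>c. [:[:c:]:]) w p) l) i \<noteq> 0"
  obtains m where "m \<in> Poly_Mapping.keys p" "Poly_Mapping.keys m \<subseteq> {..<3}"
    "Poly_Mapping.lookup m 0 = i" "Poly_Mapping.lookup m 1 = 0" "Poly_Mapping.lookup m 2 = l"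
proof -
  from assms(2) have "(\<Sum>m\<in>Poly_Mapping.keys p.
      coeff (coeff ([:[:Poly_Mapping.lookup p m:]:] * monomial_eval w m) l) i) \<noteq> 0"
    by (simp add: mpoly_eval_def coeff_sum)
  then obtain m where m: "m \<in> Poly_Mapping.keys p"
      "coeff (coeff ([:[:Poly_Mapping.lookup p m:]:] * monomial_eval w m) l) i \<noteq> 0"
    by (meson sum.neutral)
  then have nz: "coeff (coeff (monomial_eval w m) l) i \<noteq> 0" by auto
  have sub: "Poly_Mapping.keys m \<subseteq> {0, 2}"
  proof
    fix j assume j: "j \<in> Poly_Mapping.keys m"
    show "j \<in> {0, 2}"
    proof (rule ccontr)
      assume "j \<notin> {0, 2}"
      with j have "monomial_eval w m = 0"
        unfolding monomial_eval_def
        by (intro prod_zero bexI[of _ j]) (auto simp: w_def in_keys_iff zero_power)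
      with nz show False by simp
    qed
  qed
  have "monomial_eval w m = (\<Prod>j\<in>{0, 2}. w j ^ Poly_Mapping.lookup m j)"
    by (rule monomial_eval_superset) (use sub in auto)
  also have "\<dots> = monom (monom 1 (Poly_Mapping.lookup m 0)) (Poly_Mapping.lookup m 2)"
    by (simp add: w_def monom_altdef poly_const_pow)
  finally have "Poly_Mapping.lookup m 0 = i \<and> Poly_Mapping.lookup m 2 = l"
    using nz by (auto split: if_splits)
  moreover have "Poly_Mapping.lookup m 1 = 0"
    using sub by (auto simp: in_keys_iff)
  moreover have "Poly_Mapping.keys m \<subseteq> {..<3}"
    using sub by (rule subset_trans) auto
  ultimately show ?thesis
    using that m(1) by blast
qed

text \<open>The polynomial is P = x S^c M / y^(5c), where S = T (T + (1 - \<eta>)^2) and M is the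
  value of a quasi-invariant H. The weight c + 1 of M compensates the change of the other factors,
  and the divisibility conditions on H clear the negative powers of y. At y = 0 the coefficient of
  z^c is (c + 1) x^(2c+1).\<close>

lemma tau_invariant_exists:
  assumes c: "c \<ge> 1"
  obtains P :: "'k::field_char_0 mpoly_type" and m where "P \<in> polys_in 3" "tau (embed P) = embed P"
    "m \<in> Poly_Mapping.keys P" "Poly_Mapping.keys m \<subseteq> {..<3}"
    "Poly_Mapping.lookup m 0 + Poly_Mapping.lookup m 1 = 2 * c + 1" "Poly_Mapping.lookup m 2 = c"
proof -
  obtain H :: "'k poly poly" where H0: "coeff H 0 = monom (of_nat (c + 1)) c - monom (of_nat (c - 1)) (c + 1)"
    and degH: "\<And>l. degree (coeff H l) \<le> c + 1"
    and dvdH: "\<And>l. l \<le> c \<Longrightarrow> monom 1 (c - 4 * l) dvd coeff H l"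
    and inv: "quasi_invariant (cst :: 'k \<Rightarrow> 'k ratfun_type) c H"
    using quasi_invariant_exists[OF cst_hom c, of c] by blast
  define h where "h l i = coeff (coeff H l) i" for l i
  have h: "c \<le> i + 4 * l" if "h l i \<noteq> 0" for l i
  proof (cases "l \<le> c")
    case True
    then show ?thesis
      using dvdH[of l] that unfolding monom_1_dvd_iff' h_def by (metis le_diff_conv not_le)
  qed simp
  let ?e = "\<lambda>l i. c + 1 + 3 * l - i"
  let ?x = "mvar 0 :: 'k mpoly_type" and ?y = "mvar 1 :: 'k mpoly_type" and ?z = "mvar 2 :: 'k mpoly_type"
  define W where "W = ?x ^ 5 * ?y ^ 4 * ?z + (?x - ?y)\<^sup>2"
  \<comment> \<open>The contribution of \<eta>^i T^l to Q. The truncated exponents are exact where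
    needed: i \<le> c + 1 takes care of x, and \<open>h\<close> takes care of y whenever the
    coefficient is nonzero.\<close>
  define t where "t l i = Poly_Mapping.single 0 (h l i) * ?x ^ (c + 1 + 3 * l - i) * ?y ^ (i + 4 * l - c) * ?z ^ (c + l)" for l i
  define Q where "Q = (\<Sum>l\<le>degree H. \<Sum>i\<le>c + 1. t l i)"
  define P where "P = W ^ c * Q"
  have "W \<in> polys_in 3"
    unfolding W_def
    by (auto intro!: polys_in_add polys_in_diff polys_in_mult polys_in_power polys_in_mvar)
  then have P_in: "P \<in> polys_in 3"
    unfolding P_def Q_def t_def
    by (intro polys_in_sum polys_in_mult polys_in_power polys_in_const polys_in_mvar) auto

  define x where "x = (rvar 0 :: 'k ratfun_type)"
  define y where "y = (rvar 1 :: 'k ratfun_type)"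
  define z where "z = (rvar 2 :: 'k ratfun_type)"
  have xy: "x \<noteq> 0" "y \<noteq> 0" "x \<noteq> y"
    by (simp_all add: x_def y_def)
  define \<eta> where "\<eta> = y / x"
  define T where "T = x ^ 3 * y ^ 4 * z"
  define S where "S = T * (T + (1 - \<eta>)\<^sup>2)"
  define M where "M = bipoly_eval cst \<eta> T H"
  define w where "w = x ^ 5 * y ^ 4 * z + (x - y)\<^sup>2"
  have \<eta>: "\<eta> \<noteq> 0" "\<eta> \<noteq> 1" "y = \<eta> * x"
    using xy by (auto simp: \<eta>_def)
  have Tw: "T + (1 - \<eta>)\<^sup>2 = w / x\<^sup>2"
    using xy by (simp add: T_def \<eta>_def w_def field_simps eval_nat_numeral)
  have tau_x: "tau x = y" and tau_y: "tau y = x"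
    by (simp_all add: x_def y_def tau_rvar tau_var_def)
  have tau_z: "tau z = - w / (x ^ 4 * y ^ 5)"
    by (simp add: z_def tau_rvar tau_var_def w_def x_def y_def)
  have tau_\<eta>: "tau \<eta> = 1 / \<eta>"
    by (simp add: \<eta>_def tau_divide tau_x tau_y)
  have tau_T: "tau T = - (T + (1 - \<eta>)\<^sup>2) / \<eta>\<^sup>2"
  proof -
    have "tau T = y ^ 3 * x ^ 4 * (- w / (x ^ 4 * y ^ 5))"
      by (simp add: T_def tau.simps tau_x tau_y tau_z)
    also have "\<dots> = - (w / x\<^sup>2) / \<eta>\<^sup>2"
      using xy by (simp add: \<eta>_def field_simps eval_nat_numeral)
    finally show ?thesis by (simp only: Tw)
  qed
  have tau_S: "tau S = S / \<eta> ^ 4"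
  proof -
    have "(1 - 1 / \<eta>)\<^sup>2 = (1 - \<eta>)\<^sup>2 / \<eta>\<^sup>2"
      using \<eta> by (simp add: field_simps power2_eq_square)
    then have "tau (T + (1 - \<eta>)\<^sup>2) = - T / \<eta>\<^sup>2"
      by (simp add: tau.simps tau_T tau_\<eta> diff_divide_distrib add_divide_distrib)
    then have "tau S = (- (T + (1 - \<eta>)\<^sup>2) / \<eta>\<^sup>2) * (- T / \<eta>\<^sup>2)"
      unfolding S_def tau.mult tau_T by simp
    also have "\<dots> = S / \<eta> ^ 4"
      unfolding S_def by (simp only: times_divide_times_eq minus_mult_minus mult.commute flip: power_add) simp
    finally show ?thesis .
  qed
  have tau_M: "tau M = bipoly_eval cst (1 / \<eta>) (- (T + (1 - \<eta>)\<^sup>2) / \<eta>\<^sup>2) H"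
    unfolding M_def bipoly_eval_altdef[OF cst_hom degH] tau.sum tau.mult tau.power tau_\<eta> tau_T tau_cst ..
  have M: "M = \<eta> ^ (c + 1) * tau M"
  proof -
    have "bipoly_eval cst \<eta> T H = \<eta> ^ (c + 1) * bipoly_eval cst (1 / \<eta>) (- (T + (1 - \<eta>)\<^sup>2) / \<eta>\<^sup>2) H"
      using inv[unfolded quasi_invariant_def, rule_format, OF \<eta>(1,2)] .
    then show ?thesis
      unfolding tau_M M_def[symmetric] .
  qed

  have embed_W: "embed W = w"
    by (simp add: W_def w_def embed.simps x_def y_def z_def rvar_def)
  have embed_t: "y ^ (5 * c) * embed (t l i) = x ^ (c + 1) * y ^ (4 * c) * z ^ c * (cst (h l i) * \<eta> ^ i * T ^ l)"
    if "i \<le> c + 1" for l i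
  proof (cases "h l i = 0")
    case True
    then show ?thesis by (simp add: t_def embed.zero cst.zero)
  next
    case False
    define a where "a = c + 1 + 3 * l - i"
    define b where "b = i + 4 * l - c"
    have a: "c + 1 + 3 * l = a + i" and b: "5 * c + b = 4 * c + i + 4 * l"
      using that h[OF False] by (auto simp: a_def b_def)
    have "y ^ (5 * c) * embed (t l i) = cst (h l i) * x ^ a * y ^ (5 * c + b) * z ^ (c + l)"
      by (simp add: t_def a_def b_def embed.mult embed.power cst_def x_def y_def z_def rvar_def power_add mult_ac)
    also have "x ^ a = x ^ (c + 1 + 3 * l) / x ^ i"
      unfolding a using xy by (simp add: power_add)
    finally show ?thesis
      unfolding b T_def \<eta>_def using xy
      by (simp add: power_add power_mult_distrib power_divide mult_ac flip: power_mult)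
  qed
  have "y ^ (5 * c) * embed Q = x ^ (c + 1) * y ^ (4 * c) * z ^ c * M"
    unfolding M_def bipoly_eval_altdef[OF cst_hom degH] Q_def embed.sum sum_distrib_left
    by (intro sum.cong) (auto simp: embed_t h_def)
  then have "y ^ (5 * c) * embed P = w ^ c * (x ^ (c + 1) * y ^ (4 * c) * z ^ c * M)"
    by (simp add: P_def embed.mult embed.power embed_W mult.left_commute)
  also have "\<dots> = x * S ^ c * M"
  proof -
    have "x ^ (c + 1) * y ^ (4 * c) * z ^ c = x * (x * y ^ 4 * z) ^ c"
      by (simp add: power_mult power_mult_distrib)
    moreover have "S = w * (x * y ^ 4 * z)"
      unfolding S_def Tw using xy by (simp add: T_def eval_nat_numeral)
    moreover have "w ^ c * (x * u ^ c * M) = x * (w * u) ^ c * M" for u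
      by (simp add: power_mult_distrib)
    ultimately show ?thesis
      by (simp only:)
  qed
  finally have eP: "y ^ (5 * c) * embed P = x * S ^ c * M" .
  have tau_eP: "x ^ (5 * c) * tau (embed P) = y * (S / \<eta> ^ 4) ^ c * tau M"
    using arg_cong[OF eP, of tau] by (simp add: tau.simps tau_x tau_y tau_S)
  have "x ^ (5 * c) * (\<eta> ^ (5 * c) * embed P) = x * S ^ c * M"
    using eP unfolding \<eta>(3) by (simp add: power_mult_distrib mult_ac)
  also have "\<dots> = x * S ^ c * (\<eta> ^ (c + 1) * tau M)"
    by (subst M) simp
  \<comment> \<open>With y = \<eta> x the exponents of \<eta> agree: 5 c + 1 - 4 c = c + 1.\<close>
  also have "\<dots> = \<eta> ^ (5 * c) * (y * (S / \<eta> ^ 4) ^ c * tau M)"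
  proof -
    have "\<eta> ^ (5 * c) = \<eta> ^ c * (\<eta> ^ 4) ^ c"
      by (simp flip: power_mult power_add)
    then show ?thesis
      unfolding \<eta>(3) using \<eta>(1) by (simp add: power_divide)
  qed
  also have "\<dots> = x ^ (5 * c) * (\<eta> ^ (5 * c) * tau (embed P))"
    unfolding tau_eP[symmetric] by (simp add: mult.left_commute)
  finally have tau_P: "tau (embed P) = embed P"
    using xy \<eta> by simp

  let ?\<phi> = "\<lambda>c::'k. [:[:c:]:]"
  let ?w = "\<lambda>i::nat. if i = 0 then [:[:0, 1:]:] else if i = 2 then [:0, 1:] else (0 :: 'k poly poly)"
  interpret \<phi>: unital_ring_hom ?\<phi>
    by unfold_locales (simp_all flip: one_pCons)
  interpret e: unital_ring_hom "mpoly_eval ?\<phi> ?w" by (rule \<phi>.mpoly_eval_hom)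
  have e_mvar: "mpoly_eval ?\<phi> ?w (mvar i) = ?w i" for i
    by (simp add: mvar_def flip: one_pCons)
  \<comment> \<open>At y = 0, W becomes x^2, so W^c supplies x^(2c) of the monomial sought.\<close>
  have "mpoly_eval ?\<phi> ?w W = [:monom 1 2:]"
    by (simp add: W_def e.simps e_mvar monom_altdef power2_eq_square)
  moreover have "mpoly_eval ?\<phi> ?w (t l i) =
      monom (smult (h l i) (if i + 4 * l \<le> c then monom 1 (?e l i) else 0)) (c + l)" for l i
    by (simp add: t_def e.simps e_mvar monom_altdef poly_const_pow)
  \<comment> \<open>Only l = 0 reaches z^c; there H has the terms \<eta>^c and \<eta>^(c+1), and the
    second one keeps a factor y.\<close>
  moreover have "coeff (\<Sum>l\<le>degree H. \<Sum>i\<le>c + 1.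
      monom (smult (h l i) (if i + 4 * l \<le> c then monom 1 (?e l i) else 0)) (c + l)) c = monom (of_nat (c + 1)) 1"
  proof -
    have "coeff (\<Sum>l\<le>degree H. \<Sum>i\<le>c + 1.
      monom (smult (h l i) (if i + 4 * l \<le> c then monom 1 (?e l i) else 0)) (c + l)) c
      = (\<Sum>l\<le>degree H. if l = 0 then (\<Sum>i\<le>c + 1. smult (h 0 i) (if i \<le> c then monom 1 (c + 1 - i) else 0)) else 0)"
      unfolding coeff_sum by (intro sum.cong) auto
    also have "\<dots> = (\<Sum>i\<le>c + 1. smult (h 0 i) (if i \<le> c then monom 1 (c + 1 - i) else 0))"
      by simp
    also have "\<dots> = (\<Sum>i\<in>{c}. smult (h 0 i) (if i \<le> c then monom 1 (c + 1 - i) else 0))"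
      by (rule sum.mono_neutral_right) (auto simp: h_def H0)
    also have "\<dots> = monom (of_nat (c + 1)) 1"
      by (simp add: h_def H0 smult_monom)
    finally show ?thesis .
  qed
  ultimately have "coeff (mpoly_eval ?\<phi> ?w P) c = monom 1 2 ^ c * monom (of_nat (c + 1)) 1"
    by (simp add: P_def Q_def e.simps poly_const_pow)
  then have "coeff (coeff (mpoly_eval ?\<phi> ?w P) c) (2 * c + 1) \<noteq> 0"
    by (simp add: monom_power mult_monom del: of_nat_Suc of_nat_add)
  then obtain m where "m \<in> Poly_Mapping.keys P" "Poly_Mapping.keys m \<subseteq> {..<3}"
    "Poly_Mapping.lookup m 0 = 2 * c + 1" "Poly_Mapping.lookup m 1 = 0" "Poly_Mapping.lookup m 2 = c"
    by (rule exists_key_of_coeff)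
  with P_in tau_P that[of P m] show ?thesis by simp
qed

section \<open>The fixed field\<close>

lemma ratfun_field_simps:
  "monoid.mult (ratfun_field n) = (*)" "add (ratfun_field n) = (+)"
  "one (ratfun_field n) = 1" "zero (ratfun_field n) = 0"
  by (simp_all add: ratfun_field_def ring_of_type_algebra_def)

lemma ratfun_carrierE:
  assumes "f \<in> carrier (ratfun_field n)"
  obtains p q where "f = Fract p q" "p \<in> polys_in n" "q \<in> polys_in n" "q \<noteq> 0"
  using assms by (auto simp: ratfun_field_def)

lemma ratfun_carrierI:
  "p \<in> polys_in n \<Longrightarrow> q \<in> polys_in n \<Longrightarrow> q \<noteq> 0 \<Longrightarrow> Fract p q \<in> carrier (ratfun_field n)"
  by (auto simp: ratfun_field_def)

lemma embed_carrier: "p \<in> polys_in n \<Longrightarrow> embed p \<in> carrier (ratfun_field n)"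
  unfolding embed_def by (intro ratfun_carrierI polys_in_1) simp_all

lemma ratfun_a_inv:
  assumes "f \<in> carrier (ratfun_field n)"
  shows "\<ominus>\<^bsub>ratfun_field n\<^esub> f = - f"
proof -
  interpret Ring.field "ratfun_field n" by (rule field_ratfun_field)
  from assms obtain p q where "f = Fract p q" "p \<in> polys_in n" "q \<in> polys_in n" "q \<noteq> 0"
    by (rule ratfun_carrierE)
  then have "- f \<in> carrier (ratfun_field n)"
    by (auto intro!: ratfun_carrierI polys_in_uminus)
  with assms show ?thesis
    by (intro minus_equality) (simp_all add: ratfun_field_simps)
qed

lemma ratfun_inverse_closed:
  assumes "f \<in> carrier (ratfun_field n)"
  shows "inverse f \<in> carrier (ratfun_field n)"
proof -
  from assms obtain p q where f: "f = Fract p q" "p \<in> polys_in n" "q \<in> polys_in n" "q \<noteq> 0"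
    by (rule ratfun_carrierE)
  show ?thesis
  proof (cases "p = 0")
    case True
    with f have "inverse f = Fract 0 1" by (simp add: fract_collapse)
    then show ?thesis by (simp add: ratfun_carrierI polys_in_0 polys_in_1)
  qed (use f in \<open>auto intro: ratfun_carrierI\<close>)
qed

lemma ratfun_m_inv:
  assumes "f \<in> carrier (ratfun_field n)" "f \<noteq> 0"
  shows "inv\<^bsub>ratfun_field n\<^esub> f = inverse f"
proof -
  interpret Ring.field "ratfun_field n" by (rule field_ratfun_field)
  show ?thesis
    using assms ratfun_inverse_closed[OF assms(1)]
    by (intro comm_inv_char) (simp_all add: ratfun_field_simps)
qed

lemma ratfun_closed:
  assumes "f \<in> carrier (ratfun_field n)" "g \<in> carrier (ratfun_field n)"
  shows "f + g \<in> carrier (ratfun_field n)" "f * g \<in> carrier (ratfun_field n)"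
    "f - g \<in> carrier (ratfun_field n)" "f / g \<in> carrier (ratfun_field n)"
proof -
  interpret Ring.field "ratfun_field n" by (rule field_ratfun_field)
  have add: "a + b \<in> carrier (ratfun_field n)"
    if "a \<in> carrier (ratfun_field n)" "b \<in> carrier (ratfun_field n)" for a b
    using a_closed[OF that] by (simp add: ratfun_field_simps)
  have mult: "a * b \<in> carrier (ratfun_field n)"
    if "a \<in> carrier (ratfun_field n)" "b \<in> carrier (ratfun_field n)" for a b
    using m_closed[OF that] by (simp add: ratfun_field_simps)
  show "f + g \<in> carrier (ratfun_field n)" "f * g \<in> carrier (ratfun_field n)"
    using assms by (auto intro: add mult)
  have "- g \<in> carrier (ratfun_field n)"
    using a_inv_closed[OF assms(2)] ratfun_a_inv[OF assms(2)] by simp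
  then show "f - g \<in> carrier (ratfun_field n)"
    using add[OF assms(1)] by fastforce
  show "f / g \<in> carrier (ratfun_field n)"
    unfolding divide_inverse using assms by (intro mult ratfun_inverse_closed)
qed

lemma ratfun_power_closed: "f \<in> carrier (ratfun_field n) \<Longrightarrow> f ^ k \<in> carrier (ratfun_field n)"
proof (induction k)
  case 0
  show ?case using embed_carrier[OF polys_in_1] by (simp add: embed.one)
qed (auto intro: ratfun_closed)

text \<open>The images of the variables involve no new variables beyond x, y and z, which are
  available for n \<ge> 3.\<close>

lemma tau_closed:
  assumes n: "n \<ge> 3" and f: "f \<in> carrier (ratfun_field n)"
  shows "tau f \<in> carrier (ratfun_field n)"
proof -
  let ?C = "carrier (ratfun_field n) :: 'a ratfun_type set"
  have rvar: "rvar i \<in> ?C" if "i < n" for i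
    using that by (simp add: rvar_def embed_carrier polys_in_mvar)
  have tau_var: "tau_var i \<in> ?C" if "i < n" for i
  proof -
    have neg: "- a \<in> ?C" if "a \<in> ?C" for a
      using ratfun_closed(3)[OF embed_carrier[OF polys_in_0] that] by (simp add: embed.zero)
    then show ?thesis
      using that n unfolding tau_var_def by (auto intro!: neg rvar ratfun_closed ratfun_power_closed)
  qed
  have poly: "tau_poly p \<in> ?C" if p: "p \<in> polys_in n" for p
  proof -
    have sum: "sum g A \<in> ?C" if "\<And>a. a \<in> A \<Longrightarrow> g a \<in> ?C" for g :: "(nat \<Rightarrow>\<^sub>0 nat) \<Rightarrow> _" and A
      using that embed_carrier[OF polys_in_0]
      by (induction A rule: infinite_finite_induct) (auto simp: embed.zero intro: ratfun_closed)
    have prod: "prod g A \<in> ?C" if "\<And>a. a \<in> A \<Longrightarrow> g a \<in> ?C" for g :: "nat \<Rightarrow> _" and A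
      using that embed_carrier[OF polys_in_1]
      by (induction A rule: infinite_finite_induct) (auto simp: embed.one intro: ratfun_closed)
    show ?thesis
      unfolding tau_poly_def mpoly_eval_def monomial_eval_def
    proof (intro sum ratfun_closed(2) prod ratfun_power_closed tau_var)
      fix m i assume "m \<in> Poly_Mapping.keys p" "i \<in> Poly_Mapping.keys m"
      with p show "i < n" by (auto simp: polys_in_def)
    qed (simp add: cst_def embed_carrier polys_in_const)
  qed
  from f obtain p q where "f = Fract p q" "p \<in> polys_in n" "q \<in> polys_in n" "q \<noteq> 0"
    by (rule ratfun_carrierE)
  then show ?thesis
    by (simp add: tau_Fract ratfun_closed poly)
qed

section \<open>Invariants and the degree of the extension\<close>

definition tau_fixed :: "nat \<Rightarrow> 'k::field ratfun_type set" where
  "tau_fixed n = {f \<in> carrier (ratfun_field n). tau f = f}"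

lemma subfield_tau_fixed: "subfield (tau_fixed n) (ratfun_field n)"
proof -
  interpret Ring.field "ratfun_field n :: 'a ratfun_type ring" by (rule field_ratfun_field)
  show ?thesis
  proof (rule subfieldI', rule subringI)
    show "\<ominus>\<^bsub>ratfun_field n\<^esub> h \<in> tau_fixed n" if "h \<in> tau_fixed n" for h :: "'a ratfun_type"
      using that a_inv_closed[of h] by (auto simp: tau_fixed_def ratfun_a_inv tau.uminus)
    show "inv\<^bsub>ratfun_field n\<^esub> k \<in> tau_fixed n"
      if "k \<in> tau_fixed n - {\<zero>\<^bsub>ratfun_field n\<^esub>}" for k :: "'a ratfun_type"
      using that by (auto simp: tau_fixed_def ratfun_m_inv ratfun_field_simps tau_inverse ratfun_inverse_closed)
  qed (use one_closed in \<open>auto simp: tau_fixed_def ratfun_field_simps tau.simps intro: ratfun_closed\<close>)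
qed

text \<open>The element \<theta> = x - y changes sign under the involution, so splitting f into its
  invariant and anti-invariant halves exhibits 1, \<theta> as a basis over the fixed field.\<close>

lemma dimension_tau_fixed:
  fixes n :: nat
  assumes n: "n \<ge> 3"
  shows "ring.dimension (ratfun_field n) 2 (tau_fixed n :: 'k::field_char_0 ratfun_type set) (carrier (ratfun_field n))"
proof -
  let ?R = "ratfun_field n :: 'k ratfun_type ring" and ?L = "tau_fixed n :: 'k ratfun_type set"
  interpret Ring.field ?R by (rule field_ratfun_field)
  define \<theta> where "\<theta> = (rvar 0 - rvar 1 :: 'k ratfun_type)"
  have \<theta>: "\<theta> \<in> carrier ?R" "\<theta> \<noteq> 0" "tau \<theta> = - \<theta>"
    using n by (auto simp: \<theta>_def rvar_def[abs_def] tau_rvar[unfolded rvar_def] tau_var_def tau.diff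
        intro!: ratfun_closed embed_carrier polys_in_mvar)
  have two: "2 \<in> carrier ?R"
    using ratfun_closed(1)[OF embed_carrier[OF polys_in_1] embed_carrier[OF polys_in_1]] by (simp add: embed.one)
  have two_nz: "(2 :: 'k ratfun_type) \<noteq> 0"
    using embed_eq_0_iff[of "2 :: 'k mpoly_type"] by (simp add: embed.numeral)
  have ext: "line_extension ?L \<theta> ?L = carrier ?R"
  proof (intro equalityI subsetI)
    fix f assume "f \<in> line_extension ?L \<theta> ?L"
    then show "f \<in> carrier ?R"
      using \<theta> by (auto simp: line_extension_mem_iff tau_fixed_def)
  next
    fix f assume f: "f \<in> carrier ?R"
    define a where "a = (f - tau f) / (2 * \<theta>)"
    define b where "b = (f + tau f) / 2"
    have "tau a = - (f - tau f) / - (2 * \<theta>)"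
      by (simp add: a_def tau_divide tau.simps \<theta>)
    then have "tau a = a"
      by (simp only: minus_divide_divide a_def)
    moreover have "tau b = b"
      by (simp add: b_def tau_divide tau.simps add.commute)
    ultimately have ab: "a \<in> ?L" "b \<in> ?L"
      using f \<theta> tau_closed[OF n f] two
      by (auto simp: a_def b_def tau_fixed_def intro!: ratfun_closed)
    have a\<theta>: "a * \<theta> = (f - tau f) / 2"
      using \<theta>(2) by (simp add: a_def)
    have "a * \<theta> + b = ((f - tau f) + (f + tau f)) / 2"
      unfolding a\<theta> b_def by (rule add_divide_distrib[symmetric])
    also have "(f - tau f) + (f + tau f) = 2 * f"
      by simp
    also have "\<dots> / 2 = f"
      using two_nz by (rule nonzero_mult_div_cancel_left)
    finally have "f = a * \<theta> + b" ..
    with ab show "f \<in> line_extension ?L \<theta> ?L"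
      by (auto simp: line_extension_mem_iff ratfun_field_simps)
  qed
  have "\<theta> \<notin> ?L"
    using \<theta> two_nz by (auto simp: tau_fixed_def)
  with dimension.Suc_dim[OF \<theta>(1) _ dimension_one[OF subfield_tau_fixed]]
  have "dimension (Suc 1) ?L (line_extension ?L \<theta> ?L)" by blast
  then show ?thesis
    by (simp add: ext numeral_2_eq_2)
qed

text \<open>The inequality \<open>l \<le> N (i + j - 2l)\<close>, rearranged to avoid truncated subtraction.\<close>

definition slope_bounded :: "nat \<Rightarrow> 'k::zero mpoly_type \<Rightarrow> bool" where
  "slope_bounded N p \<longleftrightarrow> (\<forall>m\<in>Poly_Mapping.keys p. Poly_Mapping.keys m \<subseteq> {..<3} \<longrightarrow>
     Poly_Mapping.lookup m 2 + 2 * N * Poly_Mapping.lookup m 2 \<le>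
       N * (Poly_Mapping.lookup m 0 + Poly_Mapping.lookup m 1))"

text \<open>The inequality is linear in the exponents and every monomial of a product is a sum of
  monomials of the factors. Exponents are nonnegative, so a sum avoiding the later variables has
  summands that avoid them too.\<close>

lemma slope_bounded_closed:
  fixes p q :: "'k::field mpoly_type"
  assumes "slope_bounded N p" "slope_bounded N q"
  shows "slope_bounded N (- p)" "slope_bounded N (p + q)" "slope_bounded N (p * q)"
proof -
  show "slope_bounded N (- p)"
    using assms(1) by (simp add: slope_bounded_def)
  show "slope_bounded N (p + q)"
    using assms Poly_Mapping.keys_add[of p q] unfolding slope_bounded_def by blast
  show "slope_bounded N (p * q)"
    unfolding slope_bounded_def
  proof (intro ballI impI)
    fix m assume "m \<in> Poly_Mapping.keys (p * q)" and sub: "Poly_Mapping.keys m \<subseteq> {..<3}"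
    then obtain a b where ab: "m = a + b" "a \<in> Poly_Mapping.keys p" "b \<in> Poly_Mapping.keys q"
      using Poly_Mapping.keys_mult[of p q] by blast
    have "Poly_Mapping.keys a \<subseteq> Poly_Mapping.keys m" "Poly_Mapping.keys b \<subseteq> Poly_Mapping.keys m"
      by (auto simp: ab in_keys_iff lookup_add)
    with sub ab(2,3) assms
    have "Poly_Mapping.lookup a 2 + 2 * N * Poly_Mapping.lookup a 2 \<le>
        N * (Poly_Mapping.lookup a 0 + Poly_Mapping.lookup a 1)"
      "Poly_Mapping.lookup b 2 + 2 * N * Poly_Mapping.lookup b 2 \<le>
        N * (Poly_Mapping.lookup b 0 + Poly_Mapping.lookup b 1)"
      unfolding slope_bounded_def by (meson subset_trans)+
    then show "Poly_Mapping.lookup m 2 + 2 * N * Poly_Mapping.lookup m 2 \<le>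
        N * (Poly_Mapping.lookup m 0 + Poly_Mapping.lookup m 1)"
      unfolding ab(1) lookup_add by (simp add: algebra_simps)
  qed
qed

lemma slope_bounded_const: "slope_bounded N (Poly_Mapping.single 0 c)"
  by (simp add: slope_bounded_def)

text \<open>For l > 0 invariance gives i - 2 l \<ge> 1, where i is the total exponent of x and y;
  hence l \<le> N \<le> N (i - 2 l).\<close>

lemma tau_invariant_slope_bounded:
  fixes p :: "'k::field_char_0 mpoly_type"
  assumes "tau (embed p) = embed p"
    and N: "\<And>m. m \<in> Poly_Mapping.keys p \<Longrightarrow> Poly_Mapping.lookup m 2 \<le> N"
  shows "slope_bounded N p"
  unfolding slope_bounded_def
proof (intro ballI impI)
  fix m assume m: "m \<in> Poly_Mapping.keys p" "Poly_Mapping.keys m \<subseteq> {..<3}"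
  let ?i = "Poly_Mapping.lookup m 0 + Poly_Mapping.lookup m 1" and ?l = "Poly_Mapping.lookup m 2"
  have "?l = 0 \<or> 2 * ?l + 1 \<le> ?i"
    using tau_invariant_monomials[OF assms(1) m] by linarith
  then show "?l + 2 * N * ?l \<le> N * ?i"
  proof
    assume "2 * ?l + 1 \<le> ?i"
    then have "N * (2 * ?l + 1) \<le> N * ?i" by (rule mult_le_mono2)
    with N[OF m(1)] show ?thesis by (simp add: algebra_simps)
  qed simp
qed

lemma not_finitely_generated_tau_fixed:
  fixes n :: nat
  assumes n: "n \<ge> 3"
  shows "\<not> finitely_generated_algebra (ratfun_field n) constants
           (tau_fixed n \<inter> poly_subring n :: 'k::field_char_0 ratfun_type set)"
proof
  let ?A = "tau_fixed n \<inter> poly_subring n :: 'k ratfun_type set"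
  assume "finitely_generated_algebra (ratfun_field n) constants ?A"
  then obtain S where S: "finite S" "S \<subseteq> ?A" "?A = generate_ring (ratfun_field n) (constants \<union> S)"
    unfolding finitely_generated_algebra_def by blast
  have "\<forall>f\<in>S. \<exists>p. f = embed p"
    using S(2) by (auto simp: poly_subring_def embed_def)
  then obtain g where g: "\<And>f. f \<in> S \<Longrightarrow> f = embed (g f)" by metis
  define E where "E = (\<Union>f\<in>S. (\<lambda>m. Poly_Mapping.lookup m 2) ` Poly_Mapping.keys (g f))"
  have "finite E" using S(1) by (simp add: E_def)
  \<comment> \<open>N bounds the exponents of z in all the generators.\<close>
  then obtain N where N: "\<forall>e\<in>E. e \<le> N"
    unfolding finite_nat_set_iff_bounded_le by blast
  have S_bounded: "slope_bounded N (g f)" if "f \<in> S" for f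
  proof (rule tau_invariant_slope_bounded)
    show "tau (embed (g f)) = embed (g f)"
      using g[OF that] S(2) that by (auto simp: tau_fixed_def)
  qed (use that N in \<open>auto simp: E_def\<close>)
  have gen: "\<exists>p. f = embed p \<and> slope_bounded N p"
    if "f \<in> generate_ring (ratfun_field n) (constants \<union> S)" for f
    using that
  proof induction
    case one
    have "\<one>\<^bsub>ratfun_field n\<^esub> = embed (1 :: 'k mpoly_type)"
      by (simp add: ratfun_field_simps embed.one)
    moreover have "slope_bounded N (1 :: 'k mpoly_type)"
      using slope_bounded_const[of N "1 :: 'k"] by simp
    ultimately show ?case by blast
  next
    case (incl h)
    then show ?case
    proof
      assume "h \<in> constants"
      then show ?thesis
        by (auto simp: constants_def embed_def intro: slope_bounded_const)
    next
      assume "h \<in> S"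
      then show ?thesis using g S_bounded by blast
    qed
  next
    case (a_inv h)
    then have "h \<in> carrier (ratfun_field n)"
      using S(3) by (auto simp: tau_fixed_def)
    with a_inv show ?case
      by (metis ratfun_a_inv embed.uminus slope_bounded_closed(1))
  next
    case (eng_add h1 h2)
    then show ?case
      by (metis ratfun_field_simps(2) embed.add slope_bounded_closed(2))
  next
    case (eng_mult h1 h2)
    then show ?case
      by (metis ratfun_field_simps(1) embed.mult slope_bounded_closed(3))
  qed
  \<comment> \<open>This P has a monomial with l = N + 1 and i - 2 l = 1, for which the slope bound
    would say N + 1 \<le> N.\<close>
  obtain P :: "'k mpoly_type" and m where P: "P \<in> polys_in 3" "tau (embed P) = embed P"
    "m \<in> Poly_Mapping.keys P" "Poly_Mapping.keys m \<subseteq> {..<3}"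
    "Poly_Mapping.lookup m 0 + Poly_Mapping.lookup m 1 = 2 * (N + 1) + 1" "Poly_Mapping.lookup m 2 = N + 1"
    using tau_invariant_exists[of "N + 1"] by auto
  have "P \<in> polys_in n"
    using P(1) n by (force simp: polys_in_def)
  then have "embed P \<in> ?A"
    using P(2) embed_carrier by (auto simp: tau_fixed_def poly_subring_def embed_def)
  then have "\<exists>p. embed P = embed p \<and> slope_bounded N p"
    unfolding S(3) by (rule gen)
  then have "slope_bounded N P" by simp
  with P(3-6) have "N + 1 + 2 * N * (N + 1) \<le> N * (2 * (N + 1) + 1)"
    unfolding slope_bounded_def by metis
  then show False by (simp add: algebra_simps)
qed

theorem mainTheorem4:
  fixes n :: nat
  assumes "n \<ge> 3"
  shows "\<exists>L :: 'k::field_char_0 ratfun_type set.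
           subfield L (ratfun_field n) \<and> constants \<subseteq> L \<and>
           ring.dimension (ratfun_field n) 2 L (carrier (ratfun_field n)) \<and>
           \<not> finitely_generated_algebra (ratfun_field n) constants (L \<inter> poly_subring n)"
proof (intro exI conjI)
  \<comment> \<open>Proving this goal for \<open>tau_fixed n\<close> fixes the witness L.\<close>
  show "constants \<subseteq> (tau_fixed n :: 'k ratfun_type set)"
  proof
    fix f :: "'k ratfun_type" assume "f \<in> constants"
    then obtain c where "f = cst c"
      by (auto simp: constants_def cst_def embed_def)
    then show "f \<in> tau_fixed n"
      by (simp add: tau_fixed_def) (simp add: cst_def embed_carrier polys_in_const)
  qed
qed (use assms in \<open>simp_all add: subfield_tau_fixed dimension_tau_fixed not_finitely_generated_tau_fixed\<close>)

end
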